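(* Let $u$ be a sufficiently smooth solution (it suffices that $u\in C^{10}$) of the three-dimensional Helmholtz equation $\partial_x^2u+\partial_y^2u+\partial_z^2u+K^2u=f$ on a box $\Omega\subset\mathbb{R}^3$, where $K$ is a constant and $f$ is correspondingly smooth. Put $$C_1=1+\frac{K^6h^6}{20160},\quad C_2=\frac{h^2}{6}\left(1+\frac{K^2h^2}{30}+\frac{K^4h^4}{840}\right),\quad C_3=\frac{h^4}{30}\left(1+\frac{17K^2h^2}{252}\right),$$ $$C_4=K^2\left(1-\frac{K^2h^2}{12}+\frac{K^4h^4}{360}\right),\quad D_1=1-\frac{K^2h^2}{12}+\frac{K^4h^4}{360},\quad D_2=\frac{K^4h^6}{20160},$$ $$D_3=\frac{h^4}{90}\left(1+\frac{K^2h^2}{112}\right),\quad D_4=\frac{h^2}{12}\left(1-\frac{K^2h^2}{30}\right),\quad D_5=\frac{h^4}{360}\left(1-\frac{K^2h^2}{56}\right).$$ Then at every interior grid point of a uniform grid of step size $h$ on $\Omega$, as $h\to0$, $$C_1(\delta_x^2+\delta_y^2+\delta_z^2)u+C_2(\delta_x^2\delta_y^2+\delta_y^2\delta_z^2+\delta_x^2\delta_z^2)u+C_3\delta_x^2\delta_y^2\delta_z^2u+C_4u$$ $$=D_1f+D_2(\delta_x^2+\delta_y^2+\delta_z^2)f+D_3(\delta_x^2\delta_y^2+\delta_y^2\delta_z^2+\delta_x^2\delta_z^2)f+D_4(\partial_x^2+\partial_y^2+\partial_z^2)f+D_5(\delta_x^2\partial_x^2+\delta_y^2\partial_y^2+\delta_z^2\partial_z^2)f+T+O(h^8),$$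 where $$T=b_4(\partial_x^4\partial_y^4+\partial_y^4\partial_z^4+\partial_x^4\partial_z^4)u+b_5(\partial_x^4\partial_y^2+\partial_x^2\partial_y^4+\partial_y^4\partial_z^2+\partial_y^2\partial_z^4+\partial_x^4\partial_z^2+\partial_x^2\partial_z^4)f+b_3\,\partial_x^2\partial_y^2\partial_z^2f+b_6(\partial_x^6+\partial_y^6+\partial_z^6)f,$$ with $b_3=\frac{59h^6}{30240}$, $b_4=\frac{h^6}{3024}$, $b_5=-\frac{31h^6}{60480}$, $b_6=-\frac{11h^6}{60480}$. In particular the leading truncation error term $T$ is of order $h^6$ and does not contain $K$ explicitly.
   Context: For a function $\varphi$ of $(x,y,z)$ and step size $h>0$: $\delta_x^2\varphi(x,y,z)=\frac{\varphi(x-h,y,z)-2\varphi(x,y,z)+\varphi(x+h,y,z)}{h^2}$, and $\delta_y^2,\delta_z^2$ are defined analogously in the $y$ and $z$ directions; products such as $\delta_x^2\delta_y^2$ and $\delta_x^2\delta_y^2\delta_z^2$ are compositions (a 27-point stencil). $\partial_x^{r}\partial_y^{s}\partial_z^{t}\varphi$ denotes the partial derivative of order $r,s,t$ in $x,y,z$. The constant implied in $O(h^8)$ may depend on $K,u,f$ but not on $h$. *)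

theory Defs
  imports "HOL-Analysis.Analysis"
begin

text \<open>
  Points of $\mathbb{R}^3$ are vectors of type \<open>real ^ 3\<close>; the directions $x, y, z$ are the
  indices \<open>1, 2, 3 :: 3\<close>. Functions take values in a type \<open>'a\<close> that may be instantiated
  by the real or by the complex numbers; the constant \<open>K\<close> has the same type.
\<close>

text \<open>
  On the faces of a closed box \<open>\<Omega>\<close> the following is the one-sided partial derivative,
  so that \<open>Ck_on \<Omega> k\<close> means: of class $C^k$ up to the boundary. Only the values
  of \<open>\<phi>\<close> on \<open>\<Omega>\<close> matter.
\<close>

definition partial :: "(real ^ 3) set \<Rightarrow> 3 \<Rightarrow> (real ^ 3 \<Rightarrow> 'a::real_normed_vector) \<Rightarrow> real ^ 3 \<Rightarrow> 'a" where
  "partial \<Omega> i \<phi> p =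
     vector_derivative (\<lambda>t. \<phi> (p + t *\<^sub>R axis i 1)) (at 0 within {t. p + t *\<^sub>R axis i 1 \<in> \<Omega>})"

definition has_partial :: "(real ^ 3) set \<Rightarrow> 3 \<Rightarrow> (real ^ 3 \<Rightarrow> 'a::real_normed_vector) \<Rightarrow> real ^ 3 \<Rightarrow> bool" where
  "has_partial \<Omega> i \<phi> p \<longleftrightarrow>
     (\<lambda>t. \<phi> (p + t *\<^sub>R axis i 1)) differentiable (at 0 within {t. p + t *\<^sub>R axis i 1 \<in> \<Omega>})"

primrec Ck_on :: "(real ^ 3) set \<Rightarrow> nat \<Rightarrow> (real ^ 3 \<Rightarrow> 'a::real_normed_vector) \<Rightarrow> bool" where
  "Ck_on \<Omega> 0 \<phi> \<longleftrightarrow> continuous_on \<Omega> \<phi>"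
| "Ck_on \<Omega> (Suc k) \<phi> \<longleftrightarrow>
     continuous_on \<Omega> \<phi> \<and> (\<forall>i. (\<forall>p\<in>\<Omega>. has_partial \<Omega> i \<phi> p) \<and> Ck_on \<Omega> k (partial \<Omega> i \<phi>))"

definition mixed_partial ::
  "(real ^ 3) set \<Rightarrow> nat \<Rightarrow> nat \<Rightarrow> nat \<Rightarrow> (real ^ 3 \<Rightarrow> 'a::real_normed_vector) \<Rightarrow> real ^ 3 \<Rightarrow> 'a" where
  "mixed_partial \<Omega> r s t \<phi> =
     (partial \<Omega> 1 ^^ r) ((partial \<Omega> 2 ^^ s) ((partial \<Omega> 3 ^^ t) \<phi>))"

definition second_diff ::
  "real \<Rightarrow> 3 \<Rightarrow> (real ^ 3 \<Rightarrow> 'a::real_normed_field) \<Rightarrow> real ^ 3 \<Rightarrow> 'a" where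
  "second_diff h i \<phi> p =
     (\<phi> (p - h *\<^sub>R axis i 1) - 2 * \<phi> p + \<phi> (p + h *\<^sub>R axis i 1)) / of_real (h ^ 2)"

definition laplacian :: "(real ^ 3) set \<Rightarrow> (real ^ 3 \<Rightarrow> 'a::real_normed_field) \<Rightarrow> real ^ 3 \<Rightarrow> 'a" where
  "laplacian \<Omega> \<phi> p =
     mixed_partial \<Omega> 2 0 0 \<phi> p + mixed_partial \<Omega> 0 2 0 \<phi> p + mixed_partial \<Omega> 0 0 2 \<phi> p"

definition helmholtz_solution ::
  "(real ^ 3) set \<Rightarrow> 'a::real_normed_field \<Rightarrow> (real ^ 3 \<Rightarrow> 'a) \<Rightarrow> (real ^ 3 \<Rightarrow> 'a) \<Rightarrow> bool" where
  "helmholtz_solution \<Omega> K f u \<longleftrightarrow> (\<forall>p\<in>\<Omega>. laplacian \<Omega> u p + K ^ 2 * u p = f p)"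

text \<open>
  A grid point is interior if the whole 27-point stencil around it belongs to the grid. The
  origin \<open>c\<close> of the grid is arbitrary; if it is a corner of a box whose side lengths
  are multiples of \<open>h\<close>, these are the grid points not on the boundary.
\<close>

definition grid_points :: "(real ^ 3) set \<Rightarrow> real ^ 3 \<Rightarrow> real \<Rightarrow> (real ^ 3) set" where
  "grid_points \<Omega> c h = {p \<in> \<Omega>. \<forall>i. \<exists>n::int. p $ i = c $ i + of_int n * h}"

definition stencil :: "real \<Rightarrow> real ^ 3 \<Rightarrow> (real ^ 3) set" where
  "stencil h p = {q. \<forall>i. q $ i \<in> {p $ i - h, p $ i, p $ i + h}}"

definition interior_grid_points :: "(real ^ 3) set \<Rightarrow> real ^ 3 \<Rightarrow> real \<Rightarrow> (real ^ 3) set" where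
  "interior_grid_points \<Omega> c h = {p \<in> grid_points \<Omega> c h. stencil h p \<subseteq> grid_points \<Omega> c h}"

definition C\<^sub>1 :: "'a::real_normed_field \<Rightarrow> real \<Rightarrow> 'a" where
  "C\<^sub>1 K h = 1 + K ^ 6 * of_real h ^ 6 / 20160"

definition C\<^sub>2 :: "'a::real_normed_field \<Rightarrow> real \<Rightarrow> 'a" where
  "C\<^sub>2 K h = of_real h ^ 2 / 6 * (1 + K ^ 2 * of_real h ^ 2 / 30 + K ^ 4 * of_real h ^ 4 / 840)"

definition C\<^sub>3 :: "'a::real_normed_field \<Rightarrow> real \<Rightarrow> 'a" where
  "C\<^sub>3 K h = of_real h ^ 4 / 30 * (1 + 17 * K ^ 2 * of_real h ^ 2 / 252)"

definition C\<^sub>4 :: "'a::real_normed_field \<Rightarrow> real \<Rightarrow> 'a" where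
  "C\<^sub>4 K h = K ^ 2 * (1 - K ^ 2 * of_real h ^ 2 / 12 + K ^ 4 * of_real h ^ 4 / 360)"

definition D\<^sub>1 :: "'a::real_normed_field \<Rightarrow> real \<Rightarrow> 'a" where
  "D\<^sub>1 K h = 1 - K ^ 2 * of_real h ^ 2 / 12 + K ^ 4 * of_real h ^ 4 / 360"

definition D\<^sub>2 :: "'a::real_normed_field \<Rightarrow> real \<Rightarrow> 'a" where
  "D\<^sub>2 K h = K ^ 4 * of_real h ^ 6 / 20160"

definition D\<^sub>3 :: "'a::real_normed_field \<Rightarrow> real \<Rightarrow> 'a" where
  "D\<^sub>3 K h = of_real h ^ 4 / 90 * (1 + K ^ 2 * of_real h ^ 2 / 112)"

definition D\<^sub>4 :: "'a::real_normed_field \<Rightarrow> real \<Rightarrow> 'a" where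
  "D\<^sub>4 K h = of_real h ^ 2 / 12 * (1 - K ^ 2 * of_real h ^ 2 / 30)"

definition D\<^sub>5 :: "'a::real_normed_field \<Rightarrow> real \<Rightarrow> 'a" where
  "D\<^sub>5 K h = of_real h ^ 4 / 360 * (1 - K ^ 2 * of_real h ^ 2 / 56)"

definition b\<^sub>3 :: "real \<Rightarrow> real" where "b\<^sub>3 h = 59 * h ^ 6 / 30240"
definition b\<^sub>4 :: "real \<Rightarrow> real" where "b\<^sub>4 h = h ^ 6 / 3024"
definition b\<^sub>5 :: "real \<Rightarrow> real" where "b\<^sub>5 h = - (31 * h ^ 6 / 60480)"
definition b\<^sub>6 :: "real \<Rightarrow> real" where "b\<^sub>6 h = - (11 * h ^ 6 / 60480)"

definition scheme_lhs ::
  "'a::real_normed_field \<Rightarrow> real \<Rightarrow> (real ^ 3 \<Rightarrow> 'a) \<Rightarrow> real ^ 3 \<Rightarrow> 'a" where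
  "scheme_lhs K h u p =
     C\<^sub>1 K h * (second_diff h 1 u p + second_diff h 2 u p + second_diff h 3 u p)
   + C\<^sub>2 K h * (second_diff h 1 (second_diff h 2 u) p
             + second_diff h 2 (second_diff h 3 u) p
             + second_diff h 1 (second_diff h 3 u) p)
   + C\<^sub>3 K h * second_diff h 1 (second_diff h 2 (second_diff h 3 u)) p
   + C\<^sub>4 K h * u p"

definition scheme_rhs ::
  "(real ^ 3) set \<Rightarrow> 'a::real_normed_field \<Rightarrow> real \<Rightarrow> (real ^ 3 \<Rightarrow> 'a) \<Rightarrow> real ^ 3 \<Rightarrow> 'a" where
  "scheme_rhs \<Omega> K h f p =
     D\<^sub>1 K h * f p
   + D\<^sub>2 K h * (second_diff h 1 f p + second_diff h 2 f p + second_diff h 3 f p)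
   + D\<^sub>3 K h * (second_diff h 1 (second_diff h 2 f) p
             + second_diff h 2 (second_diff h 3 f) p
             + second_diff h 1 (second_diff h 3 f) p)
   + D\<^sub>4 K h * (mixed_partial \<Omega> 2 0 0 f p + mixed_partial \<Omega> 0 2 0 f p + mixed_partial \<Omega> 0 0 2 f p)
   + D\<^sub>5 K h * (second_diff h 1 (mixed_partial \<Omega> 2 0 0 f) p
             + second_diff h 2 (mixed_partial \<Omega> 0 2 0 f) p
             + second_diff h 3 (mixed_partial \<Omega> 0 0 2 f) p)"

definition leading_error ::
  "(real ^ 3) set \<Rightarrow> real \<Rightarrow> (real ^ 3 \<Rightarrow> 'a::real_normed_field) \<Rightarrow> (real ^ 3 \<Rightarrow> 'a) \<Rightarrow> real ^ 3 \<Rightarrow> 'a" where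
  "leading_error \<Omega> h u f p =
     of_real (b\<^sub>4 h) * (mixed_partial \<Omega> 4 4 0 u p + mixed_partial \<Omega> 0 4 4 u p
                     + mixed_partial \<Omega> 4 0 4 u p)
   + of_real (b\<^sub>5 h) * (mixed_partial \<Omega> 4 2 0 f p + mixed_partial \<Omega> 2 4 0 f p
                     + mixed_partial \<Omega> 0 4 2 f p + mixed_partial \<Omega> 0 2 4 f p
                     + mixed_partial \<Omega> 4 0 2 f p + mixed_partial \<Omega> 2 0 4 f p)
   + of_real (b\<^sub>3 h) * mixed_partial \<Omega> 2 2 2 f p
   + of_real (b\<^sub>6 h) * (mixed_partial \<Omega> 6 0 0 f p + mixed_partial \<Omega> 0 6 0 f p
                     + mixed_partial \<Omega> 0 0 6 f p)"

end

theory Submission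
  imports Defs
begin

text \<open>
  Write \<open>D\<^sub>i\<close> for the partial derivative in direction \<open>i\<close>. Taylor's formula expands the second
  difference in even powers of the step size,
  \<open>\<delta>\<^sub>i\<^sup>2 = D\<^sub>i\<^sup>2 + h\<^sup>2 D\<^sub>i\<^sup>4 / 12 + h\<^sup>4 D\<^sub>i\<^sup>6 / 360 + h\<^sup>6 D\<^sub>i\<^sup>8 / 20160 + O(h\<^sup>8)\<close>
  (\<open>second_diff_taylor\<close>), and the Helmholtz equation reads
  \<open>f = (D\<^sub>1\<^sup>2 + D\<^sub>2\<^sup>2 + D\<^sub>3\<^sup>2 + K\<^sup>2) u\<close>. Substituting both turns either side of the scheme into a
  polynomial in \<open>h\<^sup>2\<close> whose coefficients are even constant-coefficient differential operators
  applied to \<open>u\<close>, plus a remainder \<open>O(h\<^sup>8)\<close>. As partial derivatives commute, those operators are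
  polynomials in \<open>D\<^sub>1\<^sup>2, D\<^sub>2\<^sup>2, D\<^sub>3\<^sup>2\<close>, and the constants of the scheme and of the leading error
  are chosen such that the coefficients of \<open>h\<^sup>0, h\<^sup>2, h\<^sup>4, h\<^sup>6\<close> agree on both sides. This last point
  is a finite computation (\<open>scheme_expansion_vanishes\<close>).
  
  Two things need care. Derivatives are taken up to the boundary of the box, so their symmetry is
  proved there with one-sided derivatives (\<open>partial_commute\<close>). And remainders must be followed
  through iterated second differences, each of which divides a remainder by \<open>h\<^sup>2\<close>. For this, a
  function of \<open>h\<close> and of the point gets a grade \<open>r\<close> (\<open>has_expansion\<close>): with \<open>u\<close> of class
  $C^{2m}$ it is expanded up to an error \<open>O(h\<^sup>2\<^sup>(\<^sup>m\<^sup>-\<^sup>r\<^sup>))\<close>, and the coefficient of \<open>h\<^sup>2\<^sup>w\<close> contains derivatives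
  of order at most \<open>2 (w + r)\<close>. A second difference raises the grade by one
  (\<open>has_expansion_second_diff\<close>) and a factor \<open>h\<^sup>2\<close> lowers it by one (\<open>has_expansion_scale\<close>), while
  \<open>u\<close> has grade 0 and \<open>f\<close> has grade 1. Every summand of the scheme then has grade at most 1, so that
  ten derivatives of \<open>u\<close>, that is \<open>m = 5\<close>, leave precisely the error \<open>O(h\<^sup>8)\<close>.
\<close>

section \<open>Partial derivatives on a closed box\<close>

locale nondegenerate_box =
  fixes a b :: "real ^ 3" and \<Omega> :: "(real ^ 3) set"
  assumes nondegenerate: "\<And>i. a $ i < b $ i"
    and box_def: "\<Omega> = cbox a b"
begin

lemma in_box_iff: "p \<in> \<Omega> \<longleftrightarrow> (\<forall>i. a $ i \<le> p $ i \<and> p $ i \<le> b $ i)"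
  by (simp add: box_def mem_box_cart)

lemma line_in_box:
  assumes "p \<in> \<Omega>"
  shows "p + t *\<^sub>R axis i 1 \<in> \<Omega> \<longleftrightarrow> t \<in> {a $ i - p $ i .. b $ i - p $ i}"
  using assms by (auto simp: in_box_iff axis_def)

text \<open>
  A face of the box cuts the line through a point of it in a one-sided neighbourhood at worst, because
  no side of the box is degenerate. Hence one-sided derivatives are unique.
\<close>
lemma line_not_bot:
  assumes "p \<in> \<Omega>"
  shows "at 0 within {t. p + t *\<^sub>R axis i 1 \<in> \<Omega>} \<noteq> bot"
proof -
  have "a $ i - p $ i < b $ i - p $ i" "0 \<in> {a $ i - p $ i .. b $ i - p $ i}"
    using nondegenerate[of i] assms by (auto simp: in_box_iff)
  then have "0 islimpt {a $ i - p $ i .. b $ i - p $ i}"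
    by (simp add: islimpt_Icc)
  then show ?thesis
    unfolding line_in_box[OF assms] trivial_limit_within Collect_mem_eq by blast
qed

lemma partial_eqI:
  assumes "p \<in> \<Omega>"
    and "((\<lambda>t. \<phi> (p + t *\<^sub>R axis i 1)) has_vector_derivative D)
           (at 0 within {t. p + t *\<^sub>R axis i 1 \<in> \<Omega>})"
  shows "partial \<Omega> i \<phi> p = D" "has_partial \<Omega> i \<phi> p"
  using vector_derivative_within[OF line_not_bot[OF assms(1)] assms(2)] assms(2)
  by (auto simp: partial_def has_partial_def intro: differentiableI_vector)

lemma has_partialD:
  assumes "has_partial \<Omega> i \<phi> p"
  shows "((\<lambda>t. \<phi> (p + t *\<^sub>R axis i 1)) has_vector_derivative partial \<Omega> i \<phi> p)
           (at 0 within {t. p + t *\<^sub>R axis i 1 \<in> \<Omega>})"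
  using assms unfolding has_partial_def partial_def by (simp add: vector_derivative_works)

text \<open>
  The definition of the partial derivative differentiates at parameter 0 of the line through the point
  itself. Translating the parameter gives the derivative of a function along a whole segment.
\<close>
lemma line_has_vector_derivative:
  assumes "has_partial \<Omega> i \<phi> (p + x *\<^sub>R axis i 1)" "T \<subseteq> {t. p + t *\<^sub>R axis i 1 \<in> \<Omega>}"
  shows "((\<lambda>t. \<phi> (p + t *\<^sub>R axis i 1)) has_vector_derivative partial \<Omega> i \<phi> (p + x *\<^sub>R axis i 1))
           (at x within T)"
proof -
  let ?g = "\<lambda>t. \<phi> (p + x *\<^sub>R axis i 1 + t *\<^sub>R axis i 1)"
  have "((\<lambda>t. t - x) has_vector_derivative 1) (at x within T)"
    by (auto intro!: derivative_eq_intros)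
  moreover have "(?g has_vector_derivative partial \<Omega> i \<phi> (p + x *\<^sub>R axis i 1))
      (at (x - x) within (\<lambda>t. t - x) ` T)"
    unfolding diff_self
    by (rule has_vector_derivative_within_subset[OF has_partialD[OF assms(1)]])
      (use assms(2) in \<open>auto simp: algebra_simps\<close>)
  ultimately have "(?g \<circ> (\<lambda>t. t - x) has_vector_derivative 1 *\<^sub>R partial \<Omega> i \<phi> (p + x *\<^sub>R axis i 1))
      (at x within T)"
    by (rule vector_diff_chain_within)
  then show ?thesis by (simp add: o_def algebra_simps)
qed

lemma partial_cong:
  assumes "\<And>q. q \<in> \<Omega> \<Longrightarrow> \<phi> q = \<psi> q" "p \<in> \<Omega>"
  shows "partial \<Omega> i \<phi> p = partial \<Omega> i \<psi> p" "has_partial \<Omega> i \<phi> p \<longleftrightarrow> has_partial \<Omega> i \<psi> p"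
proof -
  have eq: "((\<lambda>t. \<phi> (p + t *\<^sub>R axis i 1)) has_vector_derivative D)
           (at 0 within {t. p + t *\<^sub>R axis i 1 \<in> \<Omega>}) \<longleftrightarrow>
        ((\<lambda>t. \<psi> (p + t *\<^sub>R axis i 1)) has_vector_derivative D)
           (at 0 within {t. p + t *\<^sub>R axis i 1 \<in> \<Omega>})" for D
    by (rule has_vector_derivative_cong_ev) (use assms in auto)
  show "partial \<Omega> i \<phi> p = partial \<Omega> i \<psi> p"
    unfolding partial_def vector_derivative_def by (simp only: eq)
  show "has_partial \<Omega> i \<phi> p \<longleftrightarrow> has_partial \<Omega> i \<psi> p"
    unfolding has_partial_def using eq
    by (meson differentiableI_vector vector_derivative_works)
qed

lemma partial_pow_cong:
  assumes "\<And>q. q \<in> \<Omega> \<Longrightarrow> \<phi> q = \<psi> q" "p \<in> \<Omega>"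
  shows "(partial \<Omega> i ^^ n) \<phi> p = (partial \<Omega> i ^^ n) \<psi> p"
  using assms by (induction n arbitrary: p) (auto intro: partial_cong(1))

lemma mixed_partial_cong:
  assumes "\<And>q. q \<in> \<Omega> \<Longrightarrow> \<phi> q = \<psi> q" "p \<in> \<Omega>"
  shows "mixed_partial \<Omega> r s t \<phi> p = mixed_partial \<Omega> r s t \<psi> p"
  unfolding mixed_partial_def using assms by (intro partial_pow_cong)

lemma Ck_cong:
  assumes "Ck_on \<Omega> k \<phi>" "\<And>q. q \<in> \<Omega> \<Longrightarrow> \<phi> q = \<psi> q"
  shows "Ck_on \<Omega> k \<psi>"
  using assms
proof (induction k arbitrary: \<phi> \<psi>)
  case 0
  then show ?case using continuous_on_cong[of \<Omega> \<Omega> \<phi> \<psi>] by simp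
next
  case (Suc k)
  have "continuous_on \<Omega> \<psi>"
    using Suc.prems continuous_on_cong[of \<Omega> \<Omega> \<phi> \<psi>] by simp
  moreover have "Ck_on \<Omega> k (partial \<Omega> i \<psi>)" for i
  proof (rule Suc.IH)
    show "Ck_on \<Omega> k (partial \<Omega> i \<phi>)" using Suc.prems(1) by simp
    show "partial \<Omega> i \<phi> q = partial \<Omega> i \<psi> q" if "q \<in> \<Omega>" for q
      by (rule partial_cong(1)) (use Suc.prems(2) that in auto)
  qed
  moreover have "has_partial \<Omega> i \<psi> q" if "q \<in> \<Omega>" for q i
  proof -
    have "has_partial \<Omega> i \<phi> q \<longleftrightarrow> has_partial \<Omega> i \<psi> q"
      by (rule partial_cong(2)) (use Suc.prems(2) that in auto)
    then show ?thesis using Suc.prems(1) that by simp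
  qed
  ultimately show ?case by simp
qed

lemma Ck_mono:
  assumes "Ck_on \<Omega> m \<phi>" "k \<le> m"
  shows "Ck_on \<Omega> k \<phi>"
  using assms
proof (induction m arbitrary: k \<phi>)
  case (Suc m)
  then show ?case by (cases k) auto
qed simp

lemma Ck_continuous: "Ck_on \<Omega> k \<phi> \<Longrightarrow> continuous_on \<Omega> \<phi>"
  by (cases k) auto

lemma Ck_has_partial: "Ck_on \<Omega> k \<phi> \<Longrightarrow> 0 < k \<Longrightarrow> p \<in> \<Omega> \<Longrightarrow> has_partial \<Omega> i \<phi> p"
  by (cases k) auto

lemma Ck_partial_pow: "Ck_on \<Omega> (m + n) \<phi> \<Longrightarrow> Ck_on \<Omega> n ((partial \<Omega> i ^^ m) \<phi>)"
  by (induction m arbitrary: n) (simp, metis Ck_on.simps(2) add_Suc add_Suc_right funpow.simps(2) o_apply)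

lemma Ck_mixed_partial:
  assumes "Ck_on \<Omega> (r + s + t + n) \<phi>"
  shows "Ck_on \<Omega> n (mixed_partial \<Omega> r s t \<phi>)"
  unfolding mixed_partial_def using assms
  by (intro Ck_partial_pow) (simp add: add_ac)

lemma partial_add:
  assumes "has_partial \<Omega> i \<phi> p" "has_partial \<Omega> i \<psi> p" "p \<in> \<Omega>"
  shows "partial \<Omega> i (\<lambda>q. \<phi> q + \<psi> q) p = partial \<Omega> i \<phi> p + partial \<Omega> i \<psi> p"
    "has_partial \<Omega> i (\<lambda>q. \<phi> q + \<psi> q) p"
  by (rule partial_eqI[OF assms(3)],
      rule has_vector_derivative_add[OF assms(1,2)[THEN has_partialD]])+

lemma partial_mult:
  fixes \<phi> :: "real ^ 3 \<Rightarrow> 'a::real_normed_field"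
  assumes "has_partial \<Omega> i \<phi> p" "p \<in> \<Omega>"
  shows "partial \<Omega> i (\<lambda>q. c * \<phi> q) p = c * partial \<Omega> i \<phi> p"
    "has_partial \<Omega> i (\<lambda>q. c * \<phi> q) p"
  by (rule partial_eqI[OF assms(2)],
      rule has_vector_derivative_mult_right[OF assms(1)[THEN has_partialD]])+

lemma Ck_add:
  assumes "Ck_on \<Omega> k \<phi>" "Ck_on \<Omega> k \<psi>"
  shows "Ck_on \<Omega> k (\<lambda>q. \<phi> q + \<psi> q)"
  using assms
proof (induction k arbitrary: \<phi> \<psi>)
  case (Suc k)
  have "Ck_on \<Omega> k (partial \<Omega> i (\<lambda>q. \<phi> q + \<psi> q))" for i
    by (rule Ck_cong[OF Suc.IH[of "partial \<Omega> i \<phi>" "partial \<Omega> i \<psi>"]])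
      (use Suc.prems in \<open>auto simp: partial_add\<close>)
  moreover have "continuous_on \<Omega> (\<lambda>q. \<phi> q + \<psi> q)"
    using Suc.prems by (simp add: continuous_on_add)
  ultimately show ?case using Suc.prems by (simp add: partial_add(2))
qed (simp add: continuous_on_add)

lemma Ck_mult:
  fixes \<phi> :: "real ^ 3 \<Rightarrow> 'a::real_normed_field"
  assumes "Ck_on \<Omega> k \<phi>"
  shows "Ck_on \<Omega> k (\<lambda>q. c * \<phi> q)"
  using assms
proof (induction k arbitrary: \<phi>)
  case (Suc k)
  have "Ck_on \<Omega> k (partial \<Omega> i (\<lambda>q. c * \<phi> q))" for i
    by (rule Ck_cong[OF Suc.IH[of "partial \<Omega> i \<phi>"]])
      (use Suc.prems in \<open>auto simp: partial_mult\<close>)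
  moreover have "continuous_on \<Omega> (\<lambda>q. c * \<phi> q)"
    using Suc.prems by (simp add: continuous_on_mult_left)
  ultimately show ?case using Suc.prems by (simp add: partial_mult(2))
qed (simp add: continuous_on_mult_left)

lemma partial_pow_add:
  assumes "Ck_on \<Omega> n \<phi>" "Ck_on \<Omega> n \<psi>" "p \<in> \<Omega>"
  shows "(partial \<Omega> i ^^ n) (\<lambda>q. \<phi> q + \<psi> q) p = (partial \<Omega> i ^^ n) \<phi> p + (partial \<Omega> i ^^ n) \<psi> p"
  using assms
proof (induction n arbitrary: \<phi> \<psi>)
  case (Suc n)
  have "(partial \<Omega> i ^^ Suc n) (\<lambda>q. \<phi> q + \<psi> q) p
      = (partial \<Omega> i ^^ n) (\<lambda>q. partial \<Omega> i \<phi> q + partial \<Omega> i \<psi> q) p"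
    unfolding funpow_Suc_right o_apply
    by (rule partial_pow_cong) (use Suc.prems in \<open>auto intro!: partial_add\<close>)
  also have "\<dots> = (partial \<Omega> i ^^ Suc n) \<phi> p + (partial \<Omega> i ^^ Suc n) \<psi> p"
    using Suc by (simp add: funpow_Suc_right del: funpow.simps)
  finally show ?case .
qed simp

lemma partial_pow_mult:
  fixes \<phi> :: "real ^ 3 \<Rightarrow> 'a::real_normed_field"
  assumes "Ck_on \<Omega> n \<phi>" "p \<in> \<Omega>"
  shows "(partial \<Omega> i ^^ n) (\<lambda>q. c * \<phi> q) p = c * (partial \<Omega> i ^^ n) \<phi> p"
  using assms
proof (induction n arbitrary: \<phi>)
  case (Suc n)
  have "(partial \<Omega> i ^^ Suc n) (\<lambda>q. c * \<phi> q) p = (partial \<Omega> i ^^ n) (\<lambda>q. c * partial \<Omega> i \<phi> q) p"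
    unfolding funpow_Suc_right o_apply
    by (rule partial_pow_cong) (use Suc.prems in \<open>auto intro!: partial_mult\<close>)
  also have "\<dots> = c * (partial \<Omega> i ^^ Suc n) \<phi> p"
    using Suc by (simp add: funpow_Suc_right del: funpow.simps)
  finally show ?case .
qed simp

lemma mixed_partial_add:
  assumes "Ck_on \<Omega> (r + s + t) \<phi>" "Ck_on \<Omega> (r + s + t) \<psi>" "p \<in> \<Omega>"
  shows "mixed_partial \<Omega> r s t (\<lambda>q. \<phi> q + \<psi> q) p
       = mixed_partial \<Omega> r s t \<phi> p + mixed_partial \<Omega> r s t \<psi> p"
proof -
  let ?X = "partial \<Omega> 1 ^^ r" and ?Y = "partial \<Omega> 2 ^^ s" and ?Z = "partial \<Omega> 3 ^^ t"
  have Z: "Ck_on \<Omega> (s + r) (?Z \<phi>)" "Ck_on \<Omega> (s + r) (?Z \<psi>)"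
    using assms by (auto intro!: Ck_partial_pow simp: add_ac)
  then have Y: "Ck_on \<Omega> r (?Y (?Z \<phi>))" "Ck_on \<Omega> r (?Y (?Z \<psi>))"
    by (auto intro!: Ck_partial_pow)
  have 1: "?Z (\<lambda>q. \<phi> q + \<psi> q) q = ?Z \<phi> q + ?Z \<psi> q" if "q \<in> \<Omega>" for q
    by (rule partial_pow_add) (use assms that in \<open>auto intro: Ck_mono\<close>)
  have 2: "?Y (?Z (\<lambda>q. \<phi> q + \<psi> q)) q = ?Y (?Z \<phi>) q + ?Y (?Z \<psi>) q" if "q \<in> \<Omega>" for q
    using partial_pow_cong[OF 1 that] partial_pow_add[OF Z[THEN Ck_mono] that, of s] by simp
  show ?thesis
    unfolding mixed_partial_def
    using partial_pow_cong[OF 2 assms(3)] partial_pow_add[OF Y assms(3)] by simp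
qed

lemma mixed_partial_mult:
  fixes \<phi> :: "real ^ 3 \<Rightarrow> 'a::real_normed_field"
  assumes "Ck_on \<Omega> (r + s + t) \<phi>" "p \<in> \<Omega>"
  shows "mixed_partial \<Omega> r s t (\<lambda>q. c * \<phi> q) p = c * mixed_partial \<Omega> r s t \<phi> p"
proof -
  let ?X = "partial \<Omega> 1 ^^ r" and ?Y = "partial \<Omega> 2 ^^ s" and ?Z = "partial \<Omega> 3 ^^ t"
  have Z: "Ck_on \<Omega> (s + r) (?Z \<phi>)"
    using assms by (auto intro!: Ck_partial_pow simp: add_ac)
  then have Y: "Ck_on \<Omega> r (?Y (?Z \<phi>))"
    by (auto intro!: Ck_partial_pow)
  have 1: "?Z (\<lambda>q. c * \<phi> q) q = c * ?Z \<phi> q" if "q \<in> \<Omega>" for q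
    by (rule partial_pow_mult) (use assms that in \<open>auto intro: Ck_mono\<close>)
  have 2: "?Y (?Z (\<lambda>q. c * \<phi> q)) q = c * ?Y (?Z \<phi>) q" if "q \<in> \<Omega>" for q
    using partial_pow_cong[OF 1 that] partial_pow_mult[OF Z[THEN Ck_mono] that, of s] by simp
  show ?thesis
    unfolding mixed_partial_def
    using partial_pow_cong[OF 2 assms(2)] partial_pow_mult[OF Y assms(2)] by simp
qed

end

section \<open>Symmetry of mixed partial derivatives\<close>

text \<open>
  The mean value inequality, applied to the function minus its supposed linear part. The segment may
  run in either direction, as is needed near the faces of the box.
\<close>
lemma mean_value_segment:
  fixes g :: "real \<Rightarrow> 'a::real_normed_vector"
  assumes "\<And>x. x \<in> closed_segment 0 s \<Longrightarrow> (g has_vector_derivative g' x) (at x within closed_segment 0 s)"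
    and "\<And>x. x \<in> closed_segment 0 s \<Longrightarrow> norm (g' x - A) \<le> B"
  shows "norm (g s - g 0 - s *\<^sub>R A) \<le> B * \<bar>s\<bar>"
proof -
  have "norm ((g s - s *\<^sub>R A) - (g 0 - 0 *\<^sub>R A)) \<le> B * norm (s - 0)"
  proof (rule differentiable_bound[where S = "closed_segment 0 s" and f' = "\<lambda>x h. h *\<^sub>R (g' x - A)"])
    fix x assume x: "x \<in> closed_segment 0 s"
    have "((\<lambda>x. g x - x *\<^sub>R A) has_vector_derivative g' x - 1 *\<^sub>R A) (at x within closed_segment 0 s)"
      by (auto intro!: derivative_eq_intros assms x)
    then show "((\<lambda>x. g x - x *\<^sub>R A) has_derivative (\<lambda>h. h *\<^sub>R (g' x - A))) (at x within closed_segment 0 s)"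
      by (simp add: has_vector_derivative_def)
    show "onorm (\<lambda>h. h *\<^sub>R (g' x - A)) \<le> B"
      using assms(2)[OF x] by (intro onorm_le) (simp add: mult.commute[of B] mult_left_mono)
  qed auto
  then show ?thesis by (simp add: algebra_simps)
qed

context nondegenerate_box
begin

text \<open>
  The mean value inequality in direction \<open>i\<close>, and then in direction \<open>j\<close> for the derivative in
  direction \<open>i\<close>, compares the mixed difference over a small rectangle with the iterated derivative at
  one corner. The difference is symmetric in the two directions, the derivative is not obviously so.
\<close>
lemma mixed_difference_approx:
  assumes "Ck_on \<Omega> 2 \<phi>" "p \<in> \<Omega>" "0 < \<epsilon>" "i \<noteq> j"
  shows "\<exists>\<delta>>0. \<forall>s t. \<bar>s\<bar> < \<delta> \<longrightarrow> \<bar>t\<bar> < \<delta> \<longrightarrow> p + s *\<^sub>R axis i 1 + t *\<^sub>R axis j 1 \<in> \<Omega> \<longrightarrow>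
     norm ((\<phi> (p + s *\<^sub>R axis i 1 + t *\<^sub>R axis j 1) - \<phi> (p + s *\<^sub>R axis i 1))
        - (\<phi> (p + t *\<^sub>R axis j 1) - \<phi> p) - (s * t) *\<^sub>R partial \<Omega> j (partial \<Omega> i \<phi>) p) \<le> \<epsilon> * \<bar>t\<bar> * \<bar>s\<bar>"
proof -
  let ?A = "partial \<Omega> j (partial \<Omega> i \<phi>) p"
  have C: "Ck_on \<Omega> 1 (partial \<Omega> i \<phi>)" "continuous_on \<Omega> (partial \<Omega> j (partial \<Omega> i \<phi>))"
    using assms(1) by (auto simp: numeral_2_eq_2)
  then obtain d where d: "d > 0"
    "\<And>q. q \<in> \<Omega> \<Longrightarrow> dist q p < d \<Longrightarrow> dist (partial \<Omega> j (partial \<Omega> i \<phi>) q) ?A < \<epsilon>"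
    using assms(2,3) unfolding continuous_on_iff by blast
  show ?thesis
  proof (intro exI[of _ "d / 2"] conjI allI impI)
    fix s t :: real
    assume st: "\<bar>s\<bar> < d / 2" "\<bar>t\<bar> < d / 2"
      and corner: "p + s *\<^sub>R axis i 1 + t *\<^sub>R axis j 1 \<in> \<Omega>"
    have seg: "(0 \<le> x \<and> x \<le> r) \<or> (r \<le> x \<and> x \<le> 0)" if "x \<in> closed_segment 0 r" for x r :: real
      using that by (auto simp: closed_segment_eq_real_ivl split: if_splits)
    have inside: "p + x *\<^sub>R axis i 1 + y *\<^sub>R axis j 1 \<in> \<Omega>"
      if "x \<in> closed_segment 0 s" "y \<in> closed_segment 0 t" for x y
      unfolding in_box_iff
    proof
      fix k
      have "a $ k \<le> p $ k \<and> p $ k \<le> b $ k"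
        "a $ k \<le> (p + s *\<^sub>R axis i 1 + t *\<^sub>R axis j 1) $ k \<and> (p + s *\<^sub>R axis i 1 + t *\<^sub>R axis j 1) $ k \<le> b $ k"
        using assms(2) corner unfolding in_box_iff by blast+
      with seg[OF that(1)] seg[OF that(2)] \<open>i \<noteq> j\<close>
      show "a $ k \<le> (p + x *\<^sub>R axis i 1 + y *\<^sub>R axis j 1) $ k \<and> (p + x *\<^sub>R axis i 1 + y *\<^sub>R axis j 1) $ k \<le> b $ k"
        by (auto simp: axis_def)
    qed
    have inside0: "p + x *\<^sub>R axis i 1 \<in> \<Omega>" if "x \<in> closed_segment 0 s" for x
      using inside[OF that, of 0] by simp
    have close: "norm (partial \<Omega> j (partial \<Omega> i \<phi>) (p + x *\<^sub>R axis i 1 + y *\<^sub>R axis j 1) - ?A) \<le> \<epsilon>"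
      if x: "x \<in> closed_segment 0 s" and y: "y \<in> closed_segment 0 t" for x y
    proof -
      have "dist (p + x *\<^sub>R axis i 1 + y *\<^sub>R axis j 1) p \<le> \<bar>x\<bar> + \<bar>y\<bar>"
        by (simp add: dist_norm add.assoc order_trans[OF norm_triangle_ineq])
      also have "\<dots> < d" using seg[OF x] seg[OF y] st by auto
      finally show ?thesis using d(2)[OF inside[OF x y]] by (simp add: dist_norm less_imp_le)
    qed
    have "norm ((\<phi> (p + t *\<^sub>R axis j 1 + s *\<^sub>R axis i 1) - \<phi> (p + s *\<^sub>R axis i 1))
        - (\<phi> (p + t *\<^sub>R axis j 1 + 0 *\<^sub>R axis i 1) - \<phi> (p + 0 *\<^sub>R axis i 1)) - s *\<^sub>R (t *\<^sub>R ?A)) \<le> (\<epsilon> * \<bar>t\<bar>) * \<bar>s\<bar>"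
    proof (rule mean_value_segment[where g' = "\<lambda>x. partial \<Omega> i \<phi> (p + t *\<^sub>R axis j 1 + x *\<^sub>R axis i 1)
          - partial \<Omega> i \<phi> (p + x *\<^sub>R axis i 1)"])
      fix x assume x: "x \<in> closed_segment 0 s"
      have sub: "closed_segment 0 s \<subseteq> {x. p + t *\<^sub>R axis j 1 + x *\<^sub>R axis i 1 \<in> \<Omega>}"
        "closed_segment 0 s \<subseteq> {x. p + x *\<^sub>R axis i 1 \<in> \<Omega>}"
        using inside[of _ t] inside0 by (auto simp: add_ac)
      show "((\<lambda>x. \<phi> (p + t *\<^sub>R axis j 1 + x *\<^sub>R axis i 1) - \<phi> (p + x *\<^sub>R axis i 1)) has_vector_derivative
          partial \<Omega> i \<phi> (p + t *\<^sub>R axis j 1 + x *\<^sub>R axis i 1) - partial \<Omega> i \<phi> (p + x *\<^sub>R axis i 1))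
          (at x within closed_segment 0 s)"
        using sub x by (intro has_vector_derivative_diff line_has_vector_derivative)
          (auto intro!: Ck_has_partial[OF assms(1)])
      have "norm (partial \<Omega> i \<phi> (p + x *\<^sub>R axis i 1 + t *\<^sub>R axis j 1)
          - partial \<Omega> i \<phi> (p + x *\<^sub>R axis i 1 + 0 *\<^sub>R axis j 1) - t *\<^sub>R ?A) \<le> \<epsilon> * \<bar>t\<bar>"
      proof (rule mean_value_segment)
        fix y assume y: "y \<in> closed_segment 0 t"
        show "((\<lambda>y. partial \<Omega> i \<phi> (p + x *\<^sub>R axis i 1 + y *\<^sub>R axis j 1)) has_vector_derivative
          partial \<Omega> j (partial \<Omega> i \<phi>) (p + x *\<^sub>R axis i 1 + y *\<^sub>R axis j 1)) (at y within closed_segment 0 t)"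
          using inside[OF x] y by (intro line_has_vector_derivative) (auto intro!: Ck_has_partial[OF C(1)])
      qed (use close x in auto)
      then show "norm (partial \<Omega> i \<phi> (p + t *\<^sub>R axis j 1 + x *\<^sub>R axis i 1) - partial \<Omega> i \<phi> (p + x *\<^sub>R axis i 1)
          - t *\<^sub>R ?A) \<le> \<epsilon> * \<bar>t\<bar>"
        by (simp add: add_ac)
    qed
    then show "norm ((\<phi> (p + s *\<^sub>R axis i 1 + t *\<^sub>R axis j 1) - \<phi> (p + s *\<^sub>R axis i 1))
        - (\<phi> (p + t *\<^sub>R axis j 1) - \<phi> p) - (s * t) *\<^sub>R ?A) \<le> \<epsilon> * \<bar>t\<bar> * \<bar>s\<bar>"
      by (simp add: add_ac)
  qed (use d in auto)
qed

lemma small_step: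
  assumes "p \<in> \<Omega>" "0 < \<delta>"
  obtains s where "s \<noteq> 0" "\<bar>s\<bar> < \<delta>" "a $ i \<le> p $ i + s" "p $ i + s \<le> b $ i"
proof -
  have *: "a $ i \<le> p $ i" "p $ i \<le> b $ i" using assms(1) by (auto simp: in_box_iff)
  show ?thesis
  proof (cases "p $ i < b $ i")
    case True
    then show ?thesis using * assms(2) by (intro that[of "min (\<delta> / 2) (b $ i - p $ i)"]) auto
  next
    case False
    then show ?thesis using * assms(2) nondegenerate[of i]
      by (intro that[of "- min (\<delta> / 2) (p $ i - a $ i)"]) auto
  qed
qed

text \<open>
  Both iterated derivatives approximate the same mixed difference, up to an error that is small
  relative to the area of the rectangle. Some small nondegenerate rectangle with the given corner
  lies in the box, also if that corner is on the boundary.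
\<close>
lemma partial_commute:
  assumes "Ck_on \<Omega> 2 \<phi>" "p \<in> \<Omega>"
  shows "partial \<Omega> i (partial \<Omega> j \<phi>) p = partial \<Omega> j (partial \<Omega> i \<phi>) p"
proof (cases "i = j")
  case False
  let ?A = "partial \<Omega> j (partial \<Omega> i \<phi>) p" and ?B = "partial \<Omega> i (partial \<Omega> j \<phi>) p"
  have "norm (?B - ?A) \<le> 0 + \<epsilon>" if "0 < \<epsilon>" for \<epsilon>
  proof -
    from that have "0 < \<epsilon> / 2" by simp
    with mixed_difference_approx[OF assms this False]
      mixed_difference_approx[OF assms this False[symmetric]]
    obtain \<delta>\<^sub>1 \<delta>\<^sub>2 where pos: "\<delta>\<^sub>1 > 0" "\<delta>\<^sub>2 > 0"
      and 1: "\<And>s t. \<bar>s\<bar> < \<delta>\<^sub>1 \<Longrightarrow> \<bar>t\<bar> < \<delta>\<^sub>1 \<Longrightarrow> p + s *\<^sub>R axis i 1 + t *\<^sub>R axis j 1 \<in> \<Omega> \<Longrightarrow>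
        norm ((\<phi> (p + s *\<^sub>R axis i 1 + t *\<^sub>R axis j 1) - \<phi> (p + s *\<^sub>R axis i 1))
        - (\<phi> (p + t *\<^sub>R axis j 1) - \<phi> p) - (s * t) *\<^sub>R ?A) \<le> \<epsilon> / 2 * \<bar>t\<bar> * \<bar>s\<bar>"
      and 2: "\<And>s t. \<bar>s\<bar> < \<delta>\<^sub>2 \<Longrightarrow> \<bar>t\<bar> < \<delta>\<^sub>2 \<Longrightarrow> p + s *\<^sub>R axis j 1 + t *\<^sub>R axis i 1 \<in> \<Omega> \<Longrightarrow>
        norm ((\<phi> (p + s *\<^sub>R axis j 1 + t *\<^sub>R axis i 1) - \<phi> (p + s *\<^sub>R axis j 1))
        - (\<phi> (p + t *\<^sub>R axis i 1) - \<phi> p) - (s * t) *\<^sub>R ?B) \<le> \<epsilon> / 2 * \<bar>t\<bar> * \<bar>s\<bar>"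
      by blast
    from pos have pos': "0 < min \<delta>\<^sub>1 \<delta>\<^sub>2" by simp
    obtain s where s: "s \<noteq> 0" "\<bar>s\<bar> < min \<delta>\<^sub>1 \<delta>\<^sub>2" "a $ i \<le> p $ i + s" "p $ i + s \<le> b $ i"
      by (rule small_step[OF assms(2) pos'])
    obtain t where t: "t \<noteq> 0" "\<bar>t\<bar> < min \<delta>\<^sub>1 \<delta>\<^sub>2" "a $ j \<le> p $ j + t" "p $ j + t \<le> b $ j"
      by (rule small_step[OF assms(2) pos'])
    let ?q = "p + s *\<^sub>R axis i 1 + t *\<^sub>R axis j 1"
    have q: "?q \<in> \<Omega>" "p + t *\<^sub>R axis j 1 + s *\<^sub>R axis i 1 = ?q"
      using assms(2) s t False by (auto simp: in_box_iff axis_def)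
    define \<Delta> where "\<Delta> = (\<phi> ?q - \<phi> (p + s *\<^sub>R axis i 1)) - (\<phi> (p + t *\<^sub>R axis j 1) - \<phi> p)"
    \<comment> \<open>the same mixed difference, compared with either of the two derivatives\<close>
    have "norm (\<Delta> - (s * t) *\<^sub>R ?A) \<le> \<epsilon> / 2 * \<bar>t\<bar> * \<bar>s\<bar>"
      using 1[of s t] s t q by (simp add: \<Delta>_def)
    moreover have "norm (\<Delta> - (s * t) *\<^sub>R ?B) \<le> \<epsilon> / 2 * \<bar>t\<bar> * \<bar>s\<bar>"
      using 2[of t s] s t q by (simp add: \<Delta>_def algebra_simps)
    ultimately have "norm ((\<Delta> - (s * t) *\<^sub>R ?A) - (\<Delta> - (s * t) *\<^sub>R ?B)) \<le> \<epsilon> * \<bar>s * t\<bar>"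
      by (intro order_trans[OF norm_triangle_ineq4]) (simp add: abs_mult mult_ac)
    also have "(\<Delta> - (s * t) *\<^sub>R ?A) - (\<Delta> - (s * t) *\<^sub>R ?B) = (s * t) *\<^sub>R (?B - ?A)"
      by (simp add: algebra_simps)
    finally have "norm (?B - ?A) * \<bar>s * t\<bar> \<le> \<epsilon> * \<bar>s * t\<bar>" by (simp add: mult.commute)
    with s(1) t(1) show ?thesis by simp
  qed
  then have "norm (?B - ?A) \<le> 0" by (rule field_le_epsilon)
  then show ?thesis by simp
qed simp

lemma partial_commute_pow:
  assumes "Ck_on \<Omega> (Suc n) \<phi>" "p \<in> \<Omega>"
  shows "partial \<Omega> i ((partial \<Omega> j ^^ n) \<phi>) p = (partial \<Omega> j ^^ n) (partial \<Omega> i \<phi>) p"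
  using assms
proof (induction n arbitrary: p)
  case (Suc n)
  have "Ck_on \<Omega> 2 ((partial \<Omega> j ^^ n) \<phi>)"
    by (rule Ck_partial_pow) (use Suc.prems in simp)
  from partial_commute[OF this Suc.prems(2)]
  have "partial \<Omega> i ((partial \<Omega> j ^^ Suc n) \<phi>) p = partial \<Omega> j (partial \<Omega> i ((partial \<Omega> j ^^ n) \<phi>)) p"
    by simp
  also have "\<dots> = partial \<Omega> j ((partial \<Omega> j ^^ n) (partial \<Omega> i \<phi>)) p"
    by (rule partial_cong(1)[OF Suc.IH])
      (auto intro: Ck_mono[OF Suc.prems(1)] Suc.prems(2) simp del: Ck_on.simps)
  finally show ?case by simp
qed simp

lemma partial_pow_commute:
  assumes "Ck_on \<Omega> (m + n) \<phi>" "p \<in> \<Omega>"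
  shows "(partial \<Omega> i ^^ m) ((partial \<Omega> j ^^ n) \<phi>) p = (partial \<Omega> j ^^ n) ((partial \<Omega> i ^^ m) \<phi>) p"
  using assms
proof (induction m arbitrary: p)
  case (Suc m)
  have "(partial \<Omega> i ^^ Suc m) ((partial \<Omega> j ^^ n) \<phi>) p
      = partial \<Omega> i ((partial \<Omega> j ^^ n) ((partial \<Omega> i ^^ m) \<phi>)) p"
    unfolding funpow.simps o_apply
    by (rule partial_cong(1)[OF Suc.IH])
      (auto intro: Ck_mono[OF Suc.prems(1)] Suc.prems(2) simp del: Ck_on.simps)
  also have "\<dots> = (partial \<Omega> j ^^ n) (partial \<Omega> i ((partial \<Omega> i ^^ m) \<phi>)) p"
    by (rule partial_commute_pow, rule Ck_partial_pow) (use Suc.prems in simp_all)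
  finally show ?case by simp
qed simp

end

section \<open>Taylor expansion of the second difference\<close>

text \<open>
  Adding the Taylor polynomials for the steps \<open>h\<close> and \<open>- h\<close> cancels the odd powers.
\<close>
lemma sum_even_part:
  fixes D :: "nat \<Rightarrow> 'a::real_vector"
  shows "(\<Sum>k<2 * N + 2. (h ^ k / fact k) *\<^sub>R D k) + (\<Sum>k<2 * N + 2. ((- h) ^ k / fact k) *\<^sub>R D k)
       = 2 *\<^sub>R D 0 + (\<Sum>l<N. (2 * h ^ (2 * l + 2) / fact (2 * l + 2)) *\<^sub>R D (2 * l + 2))"
proof (induction N)
  case 0
  then show ?case by (simp add: numeral_2_eq_2 scaleR_2[symmetric])
next
  case (Suc N)
  have two: "2 * Suc N + 2 = Suc (Suc (2 * N + 2))" by simp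
  have even: "((- h) ^ (2 * N + 2) / fact (2 * N + 2)) *\<^sub>R D (2 * N + 2) = (h ^ (2 * N + 2) / fact (2 * N + 2)) *\<^sub>R D (2 * N + 2)"
    and odd: "((- h) ^ Suc (2 * N + 2) / fact (Suc (2 * N + 2))) *\<^sub>R D (Suc (2 * N + 2)) = - ((h ^ Suc (2 * N + 2) / fact (Suc (2 * N + 2))) *\<^sub>R D (Suc (2 * N + 2)))"
    by simp_all
  have dbl: "x + (x :: 'a) = 2 *\<^sub>R x" for x by (simp add: scaleR_2)
  show ?case
    unfolding two sum.lessThan_Suc even odd
    using Suc.IH dbl[of "(h ^ (2 * N + 2) / fact (2 * N + 2)) *\<^sub>R D (2 * N + 2)"]
    by (simp add: algebra_simps del: fact_Suc power_Suc)
qed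

context nondegenerate_box
begin

lemma Ck_bounded:
  assumes "Ck_on \<Omega> k \<phi>"
  obtains B where "0 \<le> B" "\<And>p. p \<in> \<Omega> \<Longrightarrow> norm (\<phi> p) \<le> B"
proof -
  have "compact (\<phi> ` \<Omega>)"
    using Ck_continuous[OF assms] by (rule compact_continuous_image) (simp add: box_def)
  then obtain B where "\<And>y. y \<in> \<phi> ` \<Omega> \<Longrightarrow> norm y \<le> B"
    using compact_imp_bounded bounded_iff by metis
  then show ?thesis
    by (intro that[of "max 0 B"]) (auto simp: le_max_iff_disj)
qed

text \<open>
  Steps of either sign are treated at once: the integral form of the remainder is applied to
  \<open>t \<mapsto> \<phi> (p + \<sigma> t e\<^sub>i)\<close> on \<open>[0, \<bar>s\<bar>]\<close>, where \<open>\<sigma>\<close> is the sign of the step.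
\<close>
lemma line_taylor:
  fixes \<phi> :: "real ^ 3 \<Rightarrow> 'a::banach"
  assumes "Ck_on \<Omega> n \<phi>" "0 < n" "p \<in> \<Omega>" "p + s *\<^sub>R axis i 1 \<in> \<Omega>"
    and B: "0 \<le> B" "\<And>q. q \<in> \<Omega> \<Longrightarrow> norm ((partial \<Omega> i ^^ n) \<phi> q) \<le> B"
  shows "norm (\<phi> (p + s *\<^sub>R axis i 1) - (\<Sum>k<n. (s ^ k / fact k) *\<^sub>R (partial \<Omega> i ^^ k) \<phi> p))
       \<le> B * \<bar>s\<bar> ^ n"
proof -
  define \<sigma> where "\<sigma> = (if 0 \<le> s then 1 else - 1 :: real)"
  define r where "r = \<bar>s\<bar>"
  have \<sigma>: "\<sigma> * r = s" "\<bar>\<sigma>\<bar> = 1" and r: "0 \<le> r" by (auto simp: \<sigma>_def r_def)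
  define Df where "Df k t = \<sigma> ^ k *\<^sub>R (partial \<Omega> i ^^ k) \<phi> (p + (\<sigma> * t) *\<^sub>R axis i 1)" for k t
  have seg: "p + (\<sigma> * t) *\<^sub>R axis i 1 \<in> \<Omega>" if "0 \<le> t" "t \<le> r" for t
    using assms(4) that assms(3)[unfolded in_box_iff, rule_format, of i]
    unfolding line_in_box[OF assms(3)] by (auto simp: \<sigma>_def r_def split: if_splits)
  have deriv: "(Df k has_vector_derivative Df (Suc k) t) (at t within {0..r})"
    if "k < n" "0 \<le> t" "t \<le> r" for k t
  proof -
    have "Ck_on \<Omega> (n - k) ((partial \<Omega> i ^^ k) \<phi>)"
      by (rule Ck_partial_pow) (use assms(1) that in simp)
    then have "has_partial \<Omega> i ((partial \<Omega> i ^^ k) \<phi>) (p + (\<sigma> * t) *\<^sub>R axis i 1)"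
      using that by (intro Ck_has_partial seg) auto
    then have "((\<lambda>x. (partial \<Omega> i ^^ k) \<phi> (p + x *\<^sub>R axis i 1)) has_vector_derivative
        partial \<Omega> i ((partial \<Omega> i ^^ k) \<phi>) (p + (\<sigma> * t) *\<^sub>R axis i 1)) (at (\<sigma> * t) within (\<lambda>t. \<sigma> * t) ` {0..r})"
      by (rule line_has_vector_derivative) (use seg in auto)
    moreover have "((\<lambda>t. \<sigma> * t) has_vector_derivative \<sigma>) (at t within {0..r})"
      by (auto intro!: derivative_eq_intros)
    ultimately have "((\<lambda>x. (partial \<Omega> i ^^ k) \<phi> (p + x *\<^sub>R axis i 1)) \<circ> (\<lambda>t. \<sigma> * t) has_vector_derivative
        \<sigma> *\<^sub>R partial \<Omega> i ((partial \<Omega> i ^^ k) \<phi>) (p + (\<sigma> * t) *\<^sub>R axis i 1)) (at t within {0..r})"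
      by (intro vector_diff_chain_within)
    from has_vector_derivative_scaleR[OF DERIV_const this, of "\<sigma> ^ k"]
    show ?thesis by (simp add: Df_def[abs_def] o_def mult.commute)
  qed
  have "((\<lambda>x. ((r - x) ^ (n - 1) / fact (n - 1)) *\<^sub>R Df n x) has_integral
      Df 0 r - (\<Sum>k<n. ((r - 0) ^ k / fact k) *\<^sub>R Df k 0)) (cbox 0 r)"
    unfolding box_real by (rule Taylor_has_integral) (use assms(2) r deriv in auto)
  then have "norm (Df 0 r - (\<Sum>k<n. ((r - 0) ^ k / fact k) *\<^sub>R Df k 0)) \<le> (r ^ (n - 1) * B) * measure lborel (cbox 0 r)"
  proof (rule has_integral_bound[rotated])
    fix x assume x: "x \<in> cbox 0 r"
    have "\<bar>(r - x) ^ (n - 1) / fact (n - 1)\<bar> \<le> r ^ (n - 1)"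
    proof -
      have "\<bar>(r - x) ^ (n - 1) / fact (n - 1)\<bar> \<le> (r - x) ^ (n - 1) / 1"
        using x by (simp add: divide_le_eq mult_le_cancel_left1)
      also have "\<dots> \<le> r ^ (n - 1)" using x by (simp add: power_mono)
      finally show ?thesis .
    qed
    moreover have "norm (Df n x) \<le> B"
      using B(2)[OF seg, of x] x \<sigma>(2) by (simp add: Df_def power_abs)
    ultimately show "norm (((r - x) ^ (n - 1) / fact (n - 1)) *\<^sub>R Df n x) \<le> r ^ (n - 1) * B"
      unfolding norm_scaleR using r by (intro mult_mono) auto
  qed (use B(1) r in auto)
  moreover have "(r ^ (n - 1) * B) * measure lborel (cbox 0 r) = B * \<bar>s\<bar> ^ n"
    using r assms(2) by (cases n) (auto simp: r_def)
  moreover have "Df 0 r = \<phi> (p + s *\<^sub>R axis i 1)"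
    by (simp add: Df_def \<sigma>)
  moreover have "((r - 0) ^ k / fact k) *\<^sub>R Df k 0 = (s ^ k / fact k) *\<^sub>R (partial \<Omega> i ^^ k) \<phi> p" for k
    using \<sigma>(1) by (simp add: Df_def power_mult_distrib[symmetric] mult.commute)
  ultimately show ?thesis by (simp only:)
qed

lemma second_diff_taylor:
  fixes \<phi> :: "real ^ 3 \<Rightarrow> 'a::{real_normed_field, banach}"
  assumes "Ck_on \<Omega> (2 * N + 2) \<phi>"
  shows "\<exists>M. \<forall>h>0. \<forall>p\<in>\<Omega>. p - h *\<^sub>R axis i 1 \<in> \<Omega> \<longrightarrow> p + h *\<^sub>R axis i 1 \<in> \<Omega> \<longrightarrow>
     norm (second_diff h i \<phi> p
       - (\<Sum>l<N. of_real h ^ (2 * l) * of_real (2 / fact (2 * l + 2)) * (partial \<Omega> i ^^ (2 * l + 2)) \<phi> p))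
     \<le> M * h ^ (2 * N)"
proof -
  let ?D = "\<lambda>k. (partial \<Omega> i ^^ k) \<phi>"
  have "Ck_on \<Omega> 0 (?D (2 * N + 2))"
    by (rule Ck_partial_pow) (use assms in simp)
  then obtain B where B: "0 \<le> B" "\<And>q. q \<in> \<Omega> \<Longrightarrow> norm (?D (2 * N + 2) q) \<le> B"
    by (rule Ck_bounded) blast
  show ?thesis
  proof (intro exI[of _ "2 * B"] allI impI ballI)
    fix h :: real and p assume h: "0 < h" and p: "p \<in> \<Omega>"
      and minus: "p - h *\<^sub>R axis i 1 \<in> \<Omega>" and plus: "p + h *\<^sub>R axis i 1 \<in> \<Omega>"
    let ?P = "\<lambda>h. \<Sum>k<2 * N + 2. (h ^ k / fact k) *\<^sub>R ?D k p"
    let ?S = "\<Sum>l<N. of_real h ^ (2 * l) * of_real (2 / fact (2 * l + 2)) * ?D (2 * l + 2) p"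
    have 1: "norm (\<phi> (p + h *\<^sub>R axis i 1) - ?P h) \<le> B * h ^ (2 * N + 2)"
      using line_taylor[OF assms _ p plus B] h by simp
    have 2: "norm (\<phi> (p - h *\<^sub>R axis i 1) - ?P (- h)) \<le> B * h ^ (2 * N + 2)"
      using line_taylor[OF assms _ p, of "- h" i] minus B h by simp
    have "?P h + ?P (- h) = 2 * \<phi> p + of_real (h ^ 2) * ?S"
      unfolding sum_even_part
      by (simp add: sum_distrib_left scaleR_conv_of_real power_add mult_ac power2_eq_square)
    then have eq: "of_real (h ^ 2) * (second_diff h i \<phi> p - ?S)
        = (\<phi> (p + h *\<^sub>R axis i 1) - ?P h) + (\<phi> (p - h *\<^sub>R axis i 1) - ?P (- h))"
      using h by (simp add: second_diff_def field_simps)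
    have "h ^ 2 * norm (second_diff h i \<phi> p - ?S) = norm (of_real (h ^ 2) * (second_diff h i \<phi> p - ?S))"
      by (simp add: norm_mult norm_power)
    also have "\<dots> \<le> B * h ^ (2 * N + 2) + B * h ^ (2 * N + 2)"
      unfolding eq by (rule order_trans[OF norm_triangle_ineq add_mono[OF 1 2]])
    also have "\<dots> = h ^ 2 * (2 * B * h ^ (2 * N))"
      by (simp add: power_add power2_eq_square)
    finally show "norm (second_diff h i \<phi> p - ?S) \<le> 2 * B * h ^ (2 * N)"
      using h by simp
  qed
qed

end

section \<open>Derivatives of even order\<close>

text \<open>
  Only derivatives of even order in each variable occur, so \<open>(j, k, l)\<close> stands for the derivative
  of orders \<open>2 j, 2 k, 2 l\<close>. A summand \<open>(w, c, \<alpha>)\<close> stands for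
  \<open>h\<^sup>2\<^sup>w c\<close> times the derivative \<open>\<alpha>\<close> of \<open>u\<close>.
\<close>
type_synonym multiindex = "nat \<times> nat \<times> nat"
type_synonym 'a summand = "nat \<times> 'a \<times> multiindex"

fun half_order :: "multiindex \<Rightarrow> nat" where
  "half_order (j, k, l) = j + k + l"

fun shift :: "3 \<Rightarrow> nat \<Rightarrow> multiindex \<Rightarrow> multiindex" where
  "shift i n (j, k, l) = (if i = 1 then (j + n, k, l) else if i = 2 then (j, k + n, l) else (j, k, l + n))"

lemma half_order_shift [simp]: "half_order (shift i n \<alpha>) = half_order \<alpha> + n"
  by (cases \<alpha>) auto

fun even_partial :: "(real ^ 3) set \<Rightarrow> multiindex \<Rightarrow> (real ^ 3 \<Rightarrow> 'a::real_normed_vector) \<Rightarrow> real ^ 3 \<Rightarrow> 'a" where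
  "even_partial \<Omega> (j, k, l) = mixed_partial \<Omega> (2 * j) (2 * k) (2 * l)"

declare even_partial.simps [simp del]

context nondegenerate_box
begin

lemma Ck_even_partial:
  assumes "Ck_on \<Omega> (2 * half_order \<alpha> + n) \<phi>"
  shows "Ck_on \<Omega> n (even_partial \<Omega> \<alpha> \<phi>)"
proof -
  obtain j k l where \<alpha>: "\<alpha> = (j, k, l)" by (cases \<alpha>)
  have "2 * half_order \<alpha> + n = 2 * j + 2 * k + 2 * l + n" by (simp add: \<alpha>)
  then show ?thesis
    using assms Ck_mixed_partial[of "2 * j" "2 * k" "2 * l" n \<phi>]
    by (simp only: \<alpha> even_partial.simps)
qed

lemma even_partial_cong:
  assumes "\<And>q. q \<in> \<Omega> \<Longrightarrow> \<phi> q = \<psi> q" "p \<in> \<Omega>"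
  shows "even_partial \<Omega> \<alpha> \<phi> p = even_partial \<Omega> \<alpha> \<psi> p"
proof -
  obtain j k l where \<alpha>: "\<alpha> = (j, k, l)" by (cases \<alpha>)
  show ?thesis
    unfolding \<alpha> even_partial.simps by (rule mixed_partial_cong) (use assms in auto)
qed

text \<open>
  A derivative taken outside has to pass the derivatives in the other directions before it can be
  merged with those in its own direction.
\<close>
lemma partial_pow_mixed_partial:
  assumes "Ck_on \<Omega> (n + r + s + t) \<phi>" "p \<in> \<Omega>"
  shows "(partial \<Omega> 1 ^^ n) (mixed_partial \<Omega> r s t \<phi>) p = mixed_partial \<Omega> (n + r) s t \<phi> p"
    and "(partial \<Omega> 2 ^^ n) (mixed_partial \<Omega> r s t \<phi>) p = mixed_partial \<Omega> r (n + s) t \<phi> p"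
    and "(partial \<Omega> 3 ^^ n) (mixed_partial \<Omega> r s t \<phi>) p = mixed_partial \<Omega> r s (n + t) \<phi> p"
proof -
  let ?X = "partial \<Omega> 1 ^^ r" and ?Y = "partial \<Omega> 2 ^^ s" and ?Z = "partial \<Omega> 3 ^^ t"
  show "(partial \<Omega> 1 ^^ n) (mixed_partial \<Omega> r s t \<phi>) p = mixed_partial \<Omega> (n + r) s t \<phi> p"
    by (simp add: mixed_partial_def funpow_add)
  have Z: "Ck_on \<Omega> (n + r + s) (?Z \<phi>)"
    by (rule Ck_partial_pow) (use assms in \<open>simp add: add_ac\<close>)
  have Y: "Ck_on \<Omega> (n + r) (?Y (?Z \<phi>))"
    by (rule Ck_partial_pow) (use Z in \<open>simp add: add_ac\<close>)
  have "(partial \<Omega> 2 ^^ n) (?X (?Y (?Z \<phi>))) p = ?X ((partial \<Omega> 2 ^^ n) (?Y (?Z \<phi>))) p"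
    by (rule partial_pow_commute[OF Y assms(2)])
  then show "(partial \<Omega> 2 ^^ n) (mixed_partial \<Omega> r s t \<phi>) p = mixed_partial \<Omega> r (n + s) t \<phi> p"
    by (simp add: mixed_partial_def funpow_add)
  have "(partial \<Omega> 3 ^^ n) (?X (?Y (?Z \<phi>))) p = ?X ((partial \<Omega> 3 ^^ n) (?Y (?Z \<phi>))) p"
    by (rule partial_pow_commute[OF Y assms(2)])
  also have "\<dots> = ?X (?Y ((partial \<Omega> 3 ^^ n) (?Z \<phi>))) p"
    by (rule partial_pow_cong[OF partial_pow_commute])
      (use Ck_mono[OF Z, of "n + s"] assms(2) in auto)
  finally show "(partial \<Omega> 3 ^^ n) (mixed_partial \<Omega> r s t \<phi>) p = mixed_partial \<Omega> r s (n + t) \<phi> p"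
    by (simp add: mixed_partial_def funpow_add)
qed

lemma mixed_partial_partial_pow:
  assumes "Ck_on \<Omega> (n + r + s + t) \<phi>" "p \<in> \<Omega>"
  shows "mixed_partial \<Omega> r s t ((partial \<Omega> i ^^ n) \<phi>) p = (partial \<Omega> i ^^ n) (mixed_partial \<Omega> r s t \<phi>) p"
proof -
  let ?X = "partial \<Omega> 1 ^^ r" and ?Y = "partial \<Omega> 2 ^^ s" and ?Z = "partial \<Omega> 3 ^^ t"
    and ?I = "partial \<Omega> i ^^ n"
  have Z: "Ck_on \<Omega> (n + r + s) (?Z \<phi>)"
    by (rule Ck_partial_pow) (use assms in \<open>simp add: add_ac\<close>)
  have Y: "Ck_on \<Omega> (r + n) (?Y (?Z \<phi>))"
    by (rule Ck_partial_pow) (use Z in \<open>simp add: add_ac\<close>)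
  have 1: "?Z (?I \<phi>) q = ?I (?Z \<phi>) q" if "q \<in> \<Omega>" for q
    by (rule partial_pow_commute[OF Ck_mono[OF assms(1)] that]) simp
  have 2: "?Y (?Z (?I \<phi>)) q = ?I (?Y (?Z \<phi>)) q" if "q \<in> \<Omega>" for q
  proof -
    have "?Y (?Z (?I \<phi>)) q = ?Y (?I (?Z \<phi>)) q"
      by (rule partial_pow_cong) (use 1 that in auto)
    also have "\<dots> = ?I (?Y (?Z \<phi>)) q"
      by (rule partial_pow_commute[OF Ck_mono[OF Z] that]) simp
    finally show ?thesis .
  qed
  have "?X (?Y (?Z (?I \<phi>))) p = ?X (?I (?Y (?Z \<phi>))) p"
    by (rule partial_pow_cong) (use 2 assms(2) in auto)
  also have "\<dots> = ?I (?X (?Y (?Z \<phi>))) p"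
    by (rule partial_pow_commute[OF Y assms(2)])
  finally show ?thesis by (simp add: mixed_partial_def)
qed

lemma partial_pow_even_partial:
  assumes "Ck_on \<Omega> (2 * (n + half_order \<alpha>)) \<phi>" "p \<in> \<Omega>"
  shows "(partial \<Omega> i ^^ (2 * n)) (even_partial \<Omega> \<alpha> \<phi>) p = even_partial \<Omega> (shift i n \<alpha>) \<phi> p"
proof -
  obtain j k l where \<alpha>: "\<alpha> = (j, k, l)" by (cases \<alpha>)
  have C: "Ck_on \<Omega> (2 * n + 2 * j + 2 * k + 2 * l) \<phi>"
    using assms(1) by (simp add: \<alpha> algebra_simps)
  consider "i = 1" | "i = 2" | "i = 3" using exhaust_3[of i] by blast
  then show ?thesis
    using partial_pow_mixed_partial[OF C assms(2)]
    by cases (simp_all add: \<alpha> even_partial.simps algebra_simps)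
qed

lemma even_partial_partial_pow:
  assumes "Ck_on \<Omega> (2 * (n + half_order \<alpha>)) \<phi>" "p \<in> \<Omega>"
  shows "even_partial \<Omega> \<alpha> ((partial \<Omega> i ^^ (2 * n)) \<phi>) p = even_partial \<Omega> (shift i n \<alpha>) \<phi> p"
proof -
  obtain j k l where \<alpha>: "\<alpha> = (j, k, l)" by (cases \<alpha>)
  have C: "Ck_on \<Omega> (2 * n + 2 * j + 2 * k + 2 * l) \<phi>"
    using assms(1) by (simp add: \<alpha> algebra_simps)
  from mixed_partial_partial_pow[OF C assms(2)] partial_pow_even_partial[OF assms]
  show ?thesis by (simp add: \<alpha> even_partial.simps)
qed

lemma even_partial_helmholtz:
  fixes u f :: "real ^ 3 \<Rightarrow> 'a::real_normed_field"
  assumes u: "Ck_on \<Omega> (2 * (1 + half_order \<alpha>)) u" and f: "helmholtz_solution \<Omega> K f u" and p: "p \<in> \<Omega>"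
  shows "even_partial \<Omega> \<alpha> f p = even_partial \<Omega> (shift 1 1 \<alpha>) u p + even_partial \<Omega> (shift 2 1 \<alpha>) u p
     + even_partial \<Omega> (shift 3 1 \<alpha>) u p + K ^ 2 * even_partial \<Omega> \<alpha> u p"
proof -
  obtain j k l where \<alpha>: "\<alpha> = (j, k, l)" by (cases \<alpha>)
  let ?m = "2 * j + 2 * k + 2 * l" and ?D = "even_partial \<Omega> \<alpha>"
  let ?d = "\<lambda>i. (partial \<Omega> i ^^ 2) u"
  have d: "Ck_on \<Omega> ?m (?d i)" for i
    by (rule Ck_partial_pow) (use u in \<open>simp add: \<alpha> algebra_simps\<close>)
  have u': "Ck_on \<Omega> ?m u"
    by (rule Ck_mono[OF u]) (simp add: \<alpha>)
  have "?D f p = ?D (\<lambda>q. ((?d 1 q + ?d 2 q) + ?d 3 q) + K ^ 2 * u q) p"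
    using f by (intro even_partial_cong p)
      (simp add: helmholtz_solution_def laplacian_def mixed_partial_def)
  also have "\<dots> = ?D (?d 1) p + ?D (?d 2) p + ?D (?d 3) p + K ^ 2 * ?D u p"
    unfolding \<alpha> even_partial.simps
    by (simp only: mixed_partial_add mixed_partial_mult Ck_add Ck_mult d u' p)
  also have "\<dots> = even_partial \<Omega> (shift 1 1 \<alpha>) u p + even_partial \<Omega> (shift 2 1 \<alpha>) u p
     + even_partial \<Omega> (shift 3 1 \<alpha>) u p + K ^ 2 * even_partial \<Omega> \<alpha> u p"
    using even_partial_partial_pow[OF u p] by (simp only: mult_1_right)
  finally show ?thesis .
qed

end

section \<open>Expansions in even powers of the step size\<close>

lemma second_diff_add:
  "second_diff h i (\<lambda>q. \<phi> q + \<psi> q) p = second_diff h i \<phi> p + second_diff h i \<psi> p"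
  unfolding second_diff_def add_divide_distrib[symmetric] by (simp add: algebra_simps)

lemma second_diff_mult: "second_diff h i (\<lambda>q. c * \<phi> q) p = c * second_diff h i \<phi> p"
  by (simp add: second_diff_def algebra_simps)

text \<open>
  The points at which second differences in the directions of \<open>S\<close> can be formed.
\<close>
definition (in nondegenerate_box) reach :: "real \<Rightarrow> 3 set \<Rightarrow> (real ^ 3) set" where
  "reach h S = {p \<in> \<Omega>. \<forall>i\<in>S. p - h *\<^sub>R axis i 1 \<in> \<Omega> \<and> p + h *\<^sub>R axis i 1 \<in> \<Omega>}"

text \<open>
  The box is a product of intervals. So if every single step stays in the box, then so does a
  combination of steps in different directions, and iterated differences are defined.
\<close>
lemma (in nondegenerate_box) reach_insert:
  assumes "p \<in> reach h (insert i S)" "i \<notin> S"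
  shows "p \<in> reach h S" "p - h *\<^sub>R axis i 1 \<in> reach h S" "p + h *\<^sub>R axis i 1 \<in> reach h S"
proof -
  have p: "p \<in> \<Omega>" "\<And>j. j \<in> insert i S \<Longrightarrow> p + (- h) *\<^sub>R axis j 1 \<in> \<Omega> \<and> p + h *\<^sub>R axis j 1 \<in> \<Omega>"
    using assms(1) by (auto simp: reach_def)
  show "p \<in> reach h S" using assms(1) by (auto simp: reach_def)
  have two: "p + s *\<^sub>R axis i 1 + t *\<^sub>R axis j 1 \<in> \<Omega>"
    if "p + s *\<^sub>R axis i 1 \<in> \<Omega>" "p + t *\<^sub>R axis j 1 \<in> \<Omega>" "j \<in> S" for s t j
    unfolding in_box_iff
  proof
    fix n
    have "j \<noteq> i" using that(3) assms(2) by blast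
    then show "a $ n \<le> (p + s *\<^sub>R axis i 1 + t *\<^sub>R axis j 1) $ n \<and> (p + s *\<^sub>R axis i 1 + t *\<^sub>R axis j 1) $ n \<le> b $ n"
      using that(1,2)[unfolded in_box_iff, rule_format, of n] p(1)[unfolded in_box_iff, rule_format, of n]
      by (auto simp: axis_def split: if_splits)
  qed
  show "p - h *\<^sub>R axis i 1 \<in> reach h S" "p + h *\<^sub>R axis i 1 \<in> reach h S"
    using two[of "- h" "- h"] two[of "- h" h] two[of h "- h"] two[of h h] p
    by (auto simp: reach_def)
qed

fun scale_summand :: "'a::times \<Rightarrow> nat \<Rightarrow> 'a summand \<Rightarrow> 'a summand" where
  "scale_summand d k (w, c, \<alpha>) = (w + k, d * c, \<alpha>)"

text \<open>
  Multiplication by \<open>d h\<^sup>2\<^sup>k\<close>; summands beyond the precision of grade \<open>r\<close> are dropped.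
\<close>
definition scale_expansion :: "nat \<Rightarrow> 'a::times \<Rightarrow> nat \<Rightarrow> nat \<Rightarrow> 'a summand list \<Rightarrow> 'a summand list" where
  "scale_expansion m d k r ts = filter (\<lambda>\<tau>. fst \<tau> + r < m) (map (scale_summand d k) ts)"

fun second_diff_summand :: "nat \<Rightarrow> 3 \<Rightarrow> nat \<Rightarrow> 'a::real_normed_field summand \<Rightarrow> 'a summand list" where
  "second_diff_summand m i r (w, c, \<alpha>) =
     map (\<lambda>l. (w + l, c * of_real (2 / fact (2 * l + 2)), shift i (l + 1) \<alpha>)) [0..<m - r - w - 1]"

definition second_diff_expansion :: "nat \<Rightarrow> 3 \<Rightarrow> nat \<Rightarrow> 'a::real_normed_field summand list \<Rightarrow> 'a summand list" where
  "second_diff_expansion m i r ts = concat (map (second_diff_summand m i r) ts)"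

locale smooth_on_box = nondegenerate_box +
  fixes m :: nat and u :: "real ^ 3 \<Rightarrow> 'a::{real_normed_field, banach}"
  assumes smooth: "Ck_on \<Omega> (2 * m) u"
begin

definition expansion_value :: "'a summand list \<Rightarrow> real \<Rightarrow> real ^ 3 \<Rightarrow> 'a" where
  "expansion_value ts h p = (\<Sum>(w, c, \<alpha>)\<leftarrow>ts. of_real h ^ (2 * w) * c * even_partial \<Omega> \<alpha> u p)"

lemma expansion_value_simps [simp]:
  "expansion_value [] h p = 0"
  "expansion_value ((w, c, \<alpha>) # ts) h p = of_real h ^ (2 * w) * c * even_partial \<Omega> \<alpha> u p + expansion_value ts h p"
  "expansion_value (ts @ ts') h p = expansion_value ts h p + expansion_value ts' h p"
  by (simp_all add: expansion_value_def)

text \<open>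
  \<open>F\<close> has grade \<open>r\<close>: the larger the grade, the more derivatives are spent at each power of \<open>h\<close> and
  the fewer powers of \<open>h\<close> are controlled. The bound on the order of \<open>\<alpha>\<close> makes the derivative \<open>\<alpha>\<close> of
  \<open>u\<close> of class $C^{2(m-r-w)}$, which is what a further Taylor expansion up to the order of the
  remainder consumes.
\<close>
definition has_expansion ::
  "3 set \<Rightarrow> nat \<Rightarrow> (real \<Rightarrow> real ^ 3 \<Rightarrow> 'a) \<Rightarrow> 'a summand list \<Rightarrow> bool" where
  "has_expansion S r F ts \<longleftrightarrow>
     (\<forall>(w, c, \<alpha>) \<in> set ts. w + r < m \<and> half_order \<alpha> \<le> w + r) \<and>
     (\<exists>M. \<forall>h. 0 < h \<and> h \<le> 1 \<longrightarrow> (\<forall>p \<in> reach h S. norm (F h p - expansion_value ts h p) \<le> M * h ^ (2 * (m - r))))"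

lemma has_expansion_exact:
  assumes "\<And>w c \<alpha>. (w, c, \<alpha>) \<in> set ts \<Longrightarrow> w + r < m \<and> half_order \<alpha> \<le> w + r"
    and "\<And>h p. p \<in> \<Omega> \<Longrightarrow> F h p = expansion_value ts h p"
  shows "has_expansion S r F ts"
  using assms unfolding has_expansion_def by (auto simp: reach_def intro!: exI[of _ 0])

lemma has_expansion_mono:
  assumes "has_expansion S r F ts" "S \<subseteq> T"
  shows "has_expansion T r F ts"
proof -
  have "reach h T \<subseteq> reach h S" for h using assms(2) by (auto simp: reach_def)
  then show ?thesis using assms(1) unfolding has_expansion_def by (meson subsetD)
qed

lemma has_expansion_add:
  assumes "has_expansion S r F ts" "has_expansion S r G ts'"
  shows "has_expansion S r (\<lambda>h p. F h p + G h p) (ts @ ts')"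
proof -
  obtain M M' where M: "\<And>h p. 0 < h \<Longrightarrow> h \<le> 1 \<Longrightarrow> p \<in> reach h S \<Longrightarrow> norm (F h p - expansion_value ts h p) \<le> M * h ^ (2 * (m - r))"
    "\<And>h p. 0 < h \<Longrightarrow> h \<le> 1 \<Longrightarrow> p \<in> reach h S \<Longrightarrow> norm (G h p - expansion_value ts' h p) \<le> M' * h ^ (2 * (m - r))"
    using assms unfolding has_expansion_def by blast
  have "norm (F h p + G h p - expansion_value (ts @ ts') h p) \<le> (M + M') * h ^ (2 * (m - r))"
    if "0 < h" "h \<le> 1" "p \<in> reach h S" for h p
  proof -
    have "F h p + G h p - expansion_value (ts @ ts') h p = (F h p - expansion_value ts h p) + (G h p - expansion_value ts' h p)"
      by simp
    then show ?thesis
      using norm_triangle_mono[OF M(1)[OF that] M(2)[OF that]] by (simp only: distrib_right)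
  qed
  then show ?thesis using assms unfolding has_expansion_def by auto
qed

text \<open>
  The dropped summands are bounded multiples of high powers of \<open>h \<le> 1\<close>.
\<close>
lemma expansion_value_truncate:
  assumes "\<forall>(w, c, \<alpha>) \<in> set ts. half_order \<alpha> \<le> m"
  shows "\<exists>M. \<forall>h. 0 < h \<and> h \<le> 1 \<longrightarrow> (\<forall>p\<in>\<Omega>.
    norm (expansion_value ts h p - expansion_value (filter (\<lambda>\<tau>. fst \<tau> + r < m) ts) h p) \<le> M * h ^ (2 * (m - r)))"
  using assms
proof (induction ts)
  case (Cons \<tau> ts)
  obtain w c \<alpha> where \<tau>: "\<tau> = (w, c, \<alpha>)" by (cases \<tau>)
  have "\<forall>(w, c, \<alpha>) \<in> set ts. half_order \<alpha> \<le> m"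
    using Cons.prems by simp
  from Cons.IH[OF this]
  obtain M where M: "\<And>h p. 0 < h \<Longrightarrow> h \<le> 1 \<Longrightarrow> p \<in> \<Omega> \<Longrightarrow>
      norm (expansion_value ts h p - expansion_value (filter (\<lambda>\<tau>. fst \<tau> + r < m) ts) h p) \<le> M * h ^ (2 * (m - r))"
    by blast
  show ?case
  proof (cases "w + r < m")
    case True
    then show ?thesis using M by (intro exI[of _ M]) (simp add: \<tau>)
  next
    case False
    have "Ck_on \<Omega> 0 (even_partial \<Omega> \<alpha> u)"
      by (rule Ck_even_partial, rule Ck_mono[OF smooth]) (use Cons.prems \<tau> in auto)
    then obtain B where B: "0 \<le> B" "\<And>p. p \<in> \<Omega> \<Longrightarrow> norm (even_partial \<Omega> \<alpha> u p) \<le> B"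
      by (rule Ck_bounded) blast
    have "norm (expansion_value (\<tau> # ts) h p - expansion_value (filter (\<lambda>\<tau>. fst \<tau> + r < m) (\<tau> # ts)) h p)
        \<le> (norm c * B + M) * h ^ (2 * (m - r))" if h: "0 < h" "h \<le> 1" and p: "p \<in> \<Omega>" for h p
    proof -
      have "h ^ (2 * w) \<le> h ^ (2 * (m - r))"
        using h False by (intro power_decreasing) auto
      then have "norm (of_real h ^ (2 * w) * c * even_partial \<Omega> \<alpha> u p) \<le> h ^ (2 * (m - r)) * norm c * B"
        using B(2)[OF p] B(1) h by (auto simp: norm_mult norm_power intro!: mult_mono)
      from norm_triangle_mono[OF this M[OF h p]] False
      show ?thesis by (simp add: \<tau> algebra_simps)
    qed
    then show ?thesis by blast
  qed
qed (auto intro!: exI[of _ 0])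

text \<open>
  Each factor \<open>h\<^sup>2\<close> lowers the grade by one. A grade may also be raised at will, which only
  forgets information; this is why \<open>r\<^sub>0 \<le> r + k\<close> suffices.
\<close>
lemma has_expansion_scale:
  assumes "has_expansion S r\<^sub>0 F ts" "r\<^sub>0 \<le> r + k" "r \<le> m"
  shows "has_expansion S r (\<lambda>h p. d * of_real h ^ (2 * k) * F h p) (scale_expansion m d k r ts)"
proof -
  obtain M where ts: "\<And>w c \<alpha>. (w, c, \<alpha>) \<in> set ts \<Longrightarrow> w + r\<^sub>0 < m \<and> half_order \<alpha> \<le> w + r\<^sub>0"
    and M: "\<And>h p. 0 < h \<Longrightarrow> h \<le> 1 \<Longrightarrow> p \<in> reach h S \<Longrightarrow> norm (F h p - expansion_value ts h p) \<le> M * h ^ (2 * (m - r\<^sub>0))"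
    using assms(1) unfolding has_expansion_def by blast
  let ?ts = "map (scale_summand d k) ts"
  have v: "expansion_value ?ts h p = d * of_real h ^ (2 * k) * expansion_value ts h p" for h p
    by (induction ts) (auto simp: algebra_simps power_add)
  have "\<forall>(w, c, \<alpha>) \<in> set ?ts. half_order \<alpha> \<le> m" using ts by fastforce
  from expansion_value_truncate[OF this, where r = r]
  obtain M' where M': "\<And>h p. 0 < h \<Longrightarrow> h \<le> 1 \<Longrightarrow> p \<in> \<Omega> \<Longrightarrow>
      norm (expansion_value ?ts h p - expansion_value (scale_expansion m d k r ts) h p) \<le> M' * h ^ (2 * (m - r))"
    unfolding scale_expansion_def by blast
  have "norm (d * of_real h ^ (2 * k) * F h p - expansion_value (scale_expansion m d k r ts) h p)
      \<le> (norm d * \<bar>M\<bar> + M') * h ^ (2 * (m - r))" if h: "0 < h" "h \<le> 1" and p: "p \<in> reach h S" for h p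
  proof -
    have "norm (d * of_real h ^ (2 * k) * (F h p - expansion_value ts h p)) \<le> norm d * h ^ (2 * k) * (\<bar>M\<bar> * h ^ (2 * (m - r\<^sub>0)))"
      using order_trans[OF M[OF h p], of "\<bar>M\<bar> * h ^ (2 * (m - r\<^sub>0))"] h
      by (auto simp: norm_mult norm_power intro!: mult_mono)
    also have "\<dots> = norm d * \<bar>M\<bar> * h ^ (2 * k + 2 * (m - r\<^sub>0))"
      by (simp add: power_add)
    also have "\<dots> \<le> norm d * \<bar>M\<bar> * h ^ (2 * (m - r))"
      using h assms by (intro mult_left_mono power_decreasing) auto
    finally have "norm (d * of_real h ^ (2 * k) * F h p - expansion_value ?ts h p) \<le> norm d * \<bar>M\<bar> * h ^ (2 * (m - r))"
      by (simp add: v algebra_simps)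
    moreover have "norm (expansion_value ?ts h p - expansion_value (scale_expansion m d k r ts) h p)
        \<le> M' * h ^ (2 * (m - r))"
      using M'[OF h] p by (simp add: reach_def)
    ultimately have "norm ((d * of_real h ^ (2 * k) * F h p - expansion_value ?ts h p)
        + (expansion_value ?ts h p - expansion_value (scale_expansion m d k r ts) h p))
      \<le> norm d * \<bar>M\<bar> * h ^ (2 * (m - r)) + M' * h ^ (2 * (m - r))"
      by (rule norm_triangle_mono)
    then show ?thesis by (simp add: distrib_right)
  qed
  moreover have "w + r < m \<and> half_order \<alpha> \<le> w + r" if "(w, c, \<alpha>) \<in> set (scale_expansion m d k r ts)" for w c \<alpha>
    using that ts assms(2) unfolding scale_expansion_def by fastforce
  ultimately show ?thesis unfolding has_expansion_def by blast
qed

lemma expansion_value_map_upt: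
  "expansion_value (map g [0..<n]) h p = (\<Sum>l<n. case g l of (w, c, \<alpha>) \<Rightarrow> of_real h ^ (2 * w) * c * even_partial \<Omega> \<alpha> u p)"
proof (induction n)
  case (Suc n)
  obtain w c \<alpha> where "g n = (w, c, \<alpha>)" by (cases "g n")
  with Suc show ?case by simp
qed simp

text \<open>
  With \<open>N = m - r - w - 1\<close> the derivative \<open>\<alpha>\<close> of \<open>u\<close> is of class $C^{2N+2}$, so that Taylor's formula
  has the remainder \<open>h\<^sup>2\<^sup>N\<close>; the factor \<open>h\<^sup>2\<^sup>w\<close> completes it to \<open>h\<^sup>2\<^sup>(\<^sup>m\<^sup>-\<^sup>r\<^sup>-\<^sup>1\<^sup>)\<close>.
\<close>
lemma has_expansion_second_diff_summand:
  assumes "w + r < m" "half_order \<alpha> \<le> w + r"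
  shows "has_expansion {i} (r + 1)
    (\<lambda>h. second_diff h i (\<lambda>q. of_real h ^ (2 * w) * c * even_partial \<Omega> \<alpha> u q)) (second_diff_summand m i r (w, c, \<alpha>))"
proof -
  define N where "N = m - r - w - 1"
  have "Ck_on \<Omega> (2 * N + 2) (even_partial \<Omega> \<alpha> u)"
    by (rule Ck_even_partial, rule Ck_mono[OF smooth]) (use assms in \<open>simp add: N_def\<close>)
  from second_diff_taylor[OF this, of i]
  obtain M where M: "\<And>h p. 0 < h \<Longrightarrow> p \<in> reach h {i} \<Longrightarrow>
     norm (second_diff h i (even_partial \<Omega> \<alpha> u) p
       - (\<Sum>l<N. of_real h ^ (2 * l) * of_real (2 / fact (2 * l + 2)) * (partial \<Omega> i ^^ (2 * l + 2)) (even_partial \<Omega> \<alpha> u) p))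
     \<le> M * h ^ (2 * N)"
    unfolding reach_def by auto
  have "norm (second_diff h i (\<lambda>q. of_real h ^ (2 * w) * c * even_partial \<Omega> \<alpha> u q) p - expansion_value (second_diff_summand m i r (w, c, \<alpha>)) h p)
      \<le> norm c * M * h ^ (2 * (m - (r + 1)))" if h: "0 < h" and p: "p \<in> reach h {i}" for h p
  proof -
    have "(partial \<Omega> i ^^ (2 * l + 2)) (even_partial \<Omega> \<alpha> u) p = even_partial \<Omega> (shift i (l + 1) \<alpha>) u p" if "l < N" for l
    proof -
      have "Ck_on \<Omega> (2 * ((l + 1) + half_order \<alpha>)) u"
        by (rule Ck_mono[OF smooth]) (use assms that in \<open>simp add: N_def\<close>)
      from partial_pow_even_partial[OF this, of p i] p show ?thesis
        by (simp add: reach_def)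
    qed
    then have "expansion_value (second_diff_summand m i r (w, c, \<alpha>)) h p = of_real h ^ (2 * w) * c *
        (\<Sum>l<N. of_real h ^ (2 * l) * of_real (2 / fact (2 * l + 2)) * (partial \<Omega> i ^^ (2 * l + 2)) (even_partial \<Omega> \<alpha> u) p)"
      unfolding second_diff_summand.simps expansion_value_map_upt N_def[symmetric] sum_distrib_left
      by (intro sum.cong refl) (simp only: prod.case lessThan_iff distrib_left distrib_right power_add mult_ac)
    then have "norm (second_diff h i (\<lambda>q. of_real h ^ (2 * w) * c * even_partial \<Omega> \<alpha> u q) p - expansion_value (second_diff_summand m i r (w, c, \<alpha>)) h p)
      = h ^ (2 * w) * norm c * norm (second_diff h i (even_partial \<Omega> \<alpha> u) p
       - (\<Sum>l<N. of_real h ^ (2 * l) * of_real (2 / fact (2 * l + 2)) * (partial \<Omega> i ^^ (2 * l + 2)) (even_partial \<Omega> \<alpha> u) p))"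
      using h unfolding second_diff_mult
      by (simp only: right_diff_distrib[symmetric] norm_mult norm_power norm_of_real abs_of_pos)
    also have "\<dots> \<le> h ^ (2 * w) * norm c * (M * h ^ (2 * N))"
      using h by (intro mult_left_mono M p) auto
    also have "\<dots> = norm c * M * (h ^ (2 * w + 2 * N))"
      by (simp add: power_add)
    also have "2 * w + 2 * N = 2 * (m - (r + 1))"
      using assms by (simp add: N_def)
    finally show ?thesis .
  qed
  then have "\<exists>M'. \<forall>h. 0 < h \<and> h \<le> 1 \<longrightarrow> (\<forall>p \<in> reach h {i}.
      norm (second_diff h i (\<lambda>q. of_real h ^ (2 * w) * c * even_partial \<Omega> \<alpha> u q) p
        - expansion_value (second_diff_summand m i r (w, c, \<alpha>)) h p) \<le> M' * h ^ (2 * (m - (r + 1))))"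
    by blast
  moreover have "\<forall>(w', c', \<alpha>') \<in> set (second_diff_summand m i r (w, c, \<alpha>)).
      w' + (r + 1) < m \<and> half_order \<alpha>' \<le> w' + (r + 1)"
    using assms by auto
  ultimately show ?thesis unfolding has_expansion_def by (intro conjI)
qed

lemma has_expansion_second_diff_finite:
  assumes "\<forall>(w, c, \<alpha>) \<in> set ts. w + r < m \<and> half_order \<alpha> \<le> w + r"
  shows "has_expansion {i} (r + 1) (\<lambda>h. second_diff h i (expansion_value ts h)) (second_diff_expansion m i r ts)"
  using assms
proof (induction ts)
  case Nil
  then show ?case
    by (intro has_expansion_exact) (simp_all add: second_diff_expansion_def second_diff_def)
next
  case (Cons \<tau> ts)
  obtain w c \<alpha> where \<tau>: "\<tau> = (w, c, \<alpha>)" by (cases \<tau>)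
  have "has_expansion {i} (r + 1)
      (\<lambda>h. second_diff h i (\<lambda>q. of_real h ^ (2 * w) * c * even_partial \<Omega> \<alpha> u q)) (second_diff_summand m i r \<tau>)"
    unfolding \<tau> by (rule has_expansion_second_diff_summand) (use Cons.prems \<tau> in auto)
  from has_expansion_add[OF this Cons.IH] Cons.prems
  show ?case
    unfolding second_diff_add[symmetric] by (simp add: \<tau> second_diff_expansion_def)
qed

text \<open>
  The second difference of the remainder is estimated by brute force, without any smoothness of it in
  the point: at most four times its bound is divided by \<open>h\<^sup>2\<close>. That costs exactly the one unit of
  grade by which the expansion itself gets shorter.
\<close>
lemma has_expansion_second_diff:
  assumes F: "has_expansion S r F ts" and r: "r < m" and i: "i \<notin> S"
  shows "has_expansion (insert i S) (r + 1) (\<lambda>h. second_diff h i (F h)) (second_diff_expansion m i r ts)"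
proof -
  obtain M where ts: "\<forall>(w, c, \<alpha>) \<in> set ts. w + r < m \<and> half_order \<alpha> \<le> w + r"
    and M: "\<And>h p. 0 < h \<Longrightarrow> h \<le> 1 \<Longrightarrow> p \<in> reach h S \<Longrightarrow> norm (F h p - expansion_value ts h p) \<le> M * h ^ (2 * (m - r))"
    using F unfolding has_expansion_def by blast
  let ?R = "\<lambda>h q. F h q - expansion_value ts h q"
  have "norm (second_diff h i (?R h) p - expansion_value [] h p) \<le> 4 * M * h ^ (2 * (m - (r + 1)))"
    if h: "0 < h" "h \<le> 1" and p: "p \<in> reach h (insert i S)" for h p
  proof -
    have "norm (?R h (p - h *\<^sub>R axis i 1) - 2 * ?R h p + ?R h (p + h *\<^sub>R axis i 1))
        \<le> norm (?R h (p - h *\<^sub>R axis i 1)) + norm (2 * ?R h p) + norm (?R h (p + h *\<^sub>R axis i 1))"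
      by (intro norm_triangle_mono order_refl norm_triangle_ineq4)
    also have "\<dots> \<le> 4 * (M * h ^ (2 * (m - r)))"
      using M[OF h reach_insert(1)[OF p i]] M[OF h reach_insert(2)[OF p i]] M[OF h reach_insert(3)[OF p i]]
      by (simp add: norm_mult del: right_diff_distrib_numeral)
    also have "\<dots> = 4 * M * h ^ (2 * (m - (r + 1))) * h ^ 2"
    proof -
      have "2 * (m - r) = 2 * (m - (r + 1)) + 2" using r by simp
      then show ?thesis by (simp only: power_add mult.assoc)
    qed
    finally show ?thesis
      using h unfolding second_diff_def by (simp add: norm_divide norm_power divide_le_eq)
  qed
  then have "has_expansion (insert i S) (r + 1) (\<lambda>h. second_diff h i (?R h)) []"
    unfolding has_expansion_def by auto
  from has_expansion_add[OF has_expansion_mono[OF has_expansion_second_diff_finite[OF ts, of i]] this]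
  show ?thesis
    unfolding second_diff_add[symmetric] by simp
qed

lemma has_expansion_even_partial:
  assumes "half_order \<alpha> \<le> r" "r < m"
  shows "has_expansion S r (\<lambda>h. even_partial \<Omega> \<alpha> u) [(0, 1, \<alpha>)]"
  using assms by (intro has_expansion_exact) auto

lemma has_expansion_even_partial_helmholtz:
  assumes "helmholtz_solution \<Omega> K f u" "half_order \<alpha> + 1 \<le> r" "r < m"
  shows "has_expansion S r (\<lambda>h. even_partial \<Omega> \<alpha> f)
    [(0, 1, shift 1 1 \<alpha>), (0, 1, shift 2 1 \<alpha>), (0, 1, shift 3 1 \<alpha>), (0, K ^ 2, \<alpha>)]"
proof (rule has_expansion_exact)
  have "Ck_on \<Omega> (2 * (1 + half_order \<alpha>)) u"
    by (rule Ck_mono[OF smooth]) (use assms in simp)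
  then show "even_partial \<Omega> \<alpha> f p
      = expansion_value [(0, 1, shift 1 1 \<alpha>), (0, 1, shift 2 1 \<alpha>), (0, 1, shift 3 1 \<alpha>), (0, K ^ 2, \<alpha>)] h p"
    if "p \<in> \<Omega>" for h p
    using even_partial_helmholtz[OF _ assms(1) that] by (simp add: algebra_simps)
qed (use assms in auto)

text \<open>
  An entry \<open>(d, k, r\<^sub>0, F, ts)\<close> of the list stands for the summand \<open>d h\<^sup>2\<^sup>k F\<close>, where \<open>F\<close> has grade \<open>r\<^sub>0\<close>
  and expansion \<open>ts\<close>.
\<close>
lemma has_expansion_combination:
  assumes "\<forall>(d, k, r\<^sub>0, F, ts) \<in> set zs. has_expansion S r\<^sub>0 F ts \<and> r\<^sub>0 \<le> r + k" "r \<le> m"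
  shows "has_expansion S r (\<lambda>h p. \<Sum>(d, k, r\<^sub>0, F, ts)\<leftarrow>zs. d * of_real h ^ (2 * k) * F h p)
    (concat (map (\<lambda>(d, k, r\<^sub>0, F, ts). scale_expansion m d k r ts) zs))"
  using assms(1)
proof (induction zs)
  case Nil
  then show ?case by (intro has_expansion_exact) auto
next
  case (Cons z zs)
  obtain d k r\<^sub>0 F ts where z: "z = (d, k, r\<^sub>0, F, ts)" by (cases z)
  have "has_expansion S r (\<lambda>h p. d * of_real h ^ (2 * k) * F h p) (scale_expansion m d k r ts)"
    by (rule has_expansion_scale) (use Cons.prems z assms(2) in auto)
  from has_expansion_add[OF this Cons.IH] Cons.prems show ?case by (simp add: z)
qed

end

section \<open>The expansion of the residual\<close>

definition single_diff_expansion :: "nat \<Rightarrow> nat \<Rightarrow> 'a::real_normed_field summand list \<Rightarrow> 'a summand list" where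
  "single_diff_expansion m r ts = second_diff_expansion m 1 r ts @ second_diff_expansion m 2 r ts @ second_diff_expansion m 3 r ts"

definition double_diff_expansion :: "nat \<Rightarrow> nat \<Rightarrow> 'a::real_normed_field summand list \<Rightarrow> 'a summand list" where
  "double_diff_expansion m r ts =
     second_diff_expansion m 1 (r + 1) (second_diff_expansion m 2 r ts)
   @ second_diff_expansion m 2 (r + 1) (second_diff_expansion m 3 r ts)
   @ second_diff_expansion m 1 (r + 1) (second_diff_expansion m 3 r ts)"

definition triple_diff_expansion :: "nat \<Rightarrow> nat \<Rightarrow> 'a::real_normed_field summand list \<Rightarrow> 'a summand list" where
  "triple_diff_expansion m r ts =
     second_diff_expansion m 1 (r + 2) (second_diff_expansion m 2 (r + 1) (second_diff_expansion m 3 r ts))"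

text \<open>
  The Laplacian plus \<open>K\<^sup>2\<close>, applied to the derivative \<open>\<alpha>\<close> of \<open>u\<close>: by the Helmholtz equation, the
  derivative \<open>\<alpha>\<close> of \<open>f\<close>.
\<close>
definition helmholtz_summands :: "'a::real_normed_field \<Rightarrow> multiindex \<Rightarrow> 'a summand list" where
  "helmholtz_summands K \<alpha> = [(0, 1, shift 1 1 \<alpha>), (0, 1, shift 2 1 \<alpha>), (0, 1, shift 3 1 \<alpha>), (0, K ^ 2, \<alpha>)]"

context smooth_on_box
begin

lemma has_expansion_single_diff:
  assumes "has_expansion {} r (\<lambda>h. \<phi>) ts" "r < m"
  shows "has_expansion UNIV (r + 1)
    (\<lambda>h p. second_diff h 1 \<phi> p + second_diff h 2 \<phi> p + second_diff h 3 \<phi> p) (single_diff_expansion m r ts)"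
proof -
  have "has_expansion UNIV (r + 1) (\<lambda>h. second_diff h i \<phi>) (second_diff_expansion m i r ts)" for i
    by (rule has_expansion_mono[OF has_expansion_second_diff[OF assms]]) auto
  then show ?thesis
    unfolding single_diff_expansion_def append_assoc[symmetric] by (intro has_expansion_add)
qed

lemma has_expansion_double_diff:
  assumes "has_expansion {} r (\<lambda>h. \<phi>) ts" "r + 1 < m"
  shows "has_expansion UNIV (r + 2)
    (\<lambda>h p. second_diff h 1 (second_diff h 2 \<phi>) p + second_diff h 2 (second_diff h 3 \<phi>) p
         + second_diff h 1 (second_diff h 3 \<phi>) p) (double_diff_expansion m r ts)"
proof -
  have j: "has_expansion {j} (r + 1) (\<lambda>h. second_diff h j \<phi>) (second_diff_expansion m j r ts)" for j
    by (rule has_expansion_second_diff[OF assms(1)]) (use assms(2) in auto)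
  have "has_expansion UNIV (r + 1 + 1) (\<lambda>h. second_diff h i (second_diff h j \<phi>))
      (second_diff_expansion m i (r + 1) (second_diff_expansion m j r ts))" if "i \<noteq> j" for i j
    by (rule has_expansion_mono[OF has_expansion_second_diff[OF j assms(2)]]) (use that in auto)
  then have "has_expansion UNIV (r + 2) (\<lambda>h. second_diff h i (second_diff h j \<phi>))
      (second_diff_expansion m i (r + 1) (second_diff_expansion m j r ts))" if "i \<noteq> j" for i j
    using that by simp
  then show ?thesis
    unfolding double_diff_expansion_def append_assoc[symmetric] by (intro has_expansion_add) simp_all
qed

lemma has_expansion_triple_diff:
  assumes "has_expansion {} r (\<lambda>h. \<phi>) ts" "r + 2 < m"
  shows "has_expansion UNIV (r + 3)
    (\<lambda>h. second_diff h 1 (second_diff h 2 (second_diff h 3 \<phi>))) (triple_diff_expansion m r ts)"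
proof -
  have 3: "has_expansion {3} (r + 1) (\<lambda>h. second_diff h 3 \<phi>) (second_diff_expansion m 3 r ts)"
    by (rule has_expansion_second_diff[OF assms(1)]) (use assms(2) in auto)
  have 2: "has_expansion {2, 3} (r + 1 + 1) (\<lambda>h. second_diff h 2 (second_diff h 3 \<phi>))
      (second_diff_expansion m 2 (r + 1) (second_diff_expansion m 3 r ts))"
    by (rule has_expansion_second_diff[OF 3]) (use assms(2) in auto)
  have "has_expansion {1, 2, 3} (r + 1 + 1 + 1) (\<lambda>h. second_diff h 1 (second_diff h 2 (second_diff h 3 \<phi>)))
      (second_diff_expansion m 1 (r + 1 + 1) (second_diff_expansion m 2 (r + 1) (second_diff_expansion m 3 r ts)))"
    by (rule has_expansion_second_diff[OF 2]) (use assms(2) in auto)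
  then show ?thesis
    unfolding triple_diff_expansion_def by (simp add: UNIV_3[symmetric] numeral_3_eq_3)
qed

text \<open>
  The residual of the scheme, that is its left-hand side minus its right-hand side minus the leading
  error, with the constants of the scheme multiplied out into monomials in \<open>h\<close>. Each entry carries
  its power of \<open>h\<^sup>2\<close> and its grade before multiplication with that power. Values and expansions stand
  side by side because they are related entry by entry (\<open>scheme_terms_have_expansions\<close>), whereas the
  residual and its expansion are the two sums over the same list.
\<close>
definition scheme_terms ::
  "'a \<Rightarrow> (real ^ 3 \<Rightarrow> 'a) \<Rightarrow> ('a \<times> nat \<times> nat \<times> (real \<Rightarrow> real ^ 3 \<Rightarrow> 'a) \<times> 'a summand list) list" where
  "scheme_terms K f =
    (let u\<^sub>0 = [(0, 1, (0, 0, 0))]; f\<^sub>0 = helmholtz_summands K (0, 0, 0);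
       U = even_partial \<Omega>; r = helmholtz_summands K;
       S1 = \<lambda>\<phi> h p. second_diff h 1 \<phi> p + second_diff h 2 \<phi> p + second_diff h 3 \<phi> p;
       S2 = \<lambda>\<phi> h p. second_diff h 1 (second_diff h 2 \<phi>) p + second_diff h 2 (second_diff h 3 \<phi>) p
         + second_diff h 1 (second_diff h 3 \<phi>) p;
       S3 = \<lambda>\<phi> h. second_diff h 1 (second_diff h 2 (second_diff h 3 \<phi>));
       L = \<lambda>h p. U (1, 0, 0) f p + U (0, 1, 0) f p + U (0, 0, 1) f p;
       l = r (1, 0, 0) @ r (0, 1, 0) @ r (0, 0, 1);
       G = \<lambda>h p. second_diff h 1 (U (1, 0, 0) f) p + second_diff h 2 (U (0, 1, 0) f) p + second_diff h 3 (U (0, 0, 1) f) p;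
       g = second_diff_expansion 5 1 2 (r (1, 0, 0)) @ second_diff_expansion 5 2 2 (r (0, 1, 0))
         @ second_diff_expansion 5 3 2 (r (0, 0, 1));
       T\<^sub>4 = \<lambda>h p. U (2, 2, 0) u p + U (0, 2, 2) u p + U (2, 0, 2) u p;
       t\<^sub>4 = [(0, 1, (2, 2, 0)), (0, 1, (0, 2, 2)), (0, 1, (2, 0, 2))];
       T\<^sub>5 = \<lambda>h p. U (2, 1, 0) f p + U (1, 2, 0) f p + U (0, 2, 1) f p + U (0, 1, 2) f p
         + U (2, 0, 1) f p + U (1, 0, 2) f p;
       t\<^sub>5 = r (2, 1, 0) @ r (1, 2, 0) @ r (0, 2, 1) @ r (0, 1, 2) @ r (2, 0, 1) @ r (1, 0, 2);
       T\<^sub>6 = \<lambda>h p. U (3, 0, 0) f p + U (0, 3, 0) f p + U (0, 0, 3) f p;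
       t\<^sub>6 = r (3, 0, 0) @ r (0, 3, 0) @ r (0, 0, 3)
     in
     [(1, 0, 1, S1 u, single_diff_expansion 5 0 u\<^sub>0),
      (K ^ 6 / 20160, 3, 1, S1 u, single_diff_expansion 5 0 u\<^sub>0),
      (1 / 6, 1, 2, S2 u, double_diff_expansion 5 0 u\<^sub>0),
      (K ^ 2 / 180, 2, 2, S2 u, double_diff_expansion 5 0 u\<^sub>0),
      (K ^ 4 / 5040, 3, 2, S2 u, double_diff_expansion 5 0 u\<^sub>0),
      (1 / 30, 2, 3, S3 u, triple_diff_expansion 5 0 u\<^sub>0),
      (17 * K ^ 2 / 7560, 3, 3, S3 u, triple_diff_expansion 5 0 u\<^sub>0),
      (K ^ 2, 0, 0, \<lambda>h. u, u\<^sub>0),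
      (- (K ^ 4 / 12), 1, 0, \<lambda>h. u, u\<^sub>0),
      (K ^ 6 / 360, 2, 0, \<lambda>h. u, u\<^sub>0),
      (- 1, 0, 1, \<lambda>h. f, f\<^sub>0),
      (K ^ 2 / 12, 1, 1, \<lambda>h. f, f\<^sub>0),
      (- (K ^ 4 / 360), 2, 1, \<lambda>h. f, f\<^sub>0),
      (- (K ^ 4 / 20160), 3, 2, S1 f, single_diff_expansion 5 1 f\<^sub>0),
      (- (1 / 90), 2, 3, S2 f, double_diff_expansion 5 1 f\<^sub>0),
      (- (K ^ 2 / 10080), 3, 3, S2 f, double_diff_expansion 5 1 f\<^sub>0),
      (- (1 / 12), 1, 2, L, l),
      (K ^ 2 / 360, 2, 2, L, l),
      (- (1 / 360), 2, 3, G, g),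
      (K ^ 2 / 20160, 3, 3, G, g),
      (- (1 / 3024), 3, 4, T\<^sub>4, t\<^sub>4),
      (31 / 60480, 3, 4, T\<^sub>5, t\<^sub>5),
      (- (59 / 30240), 3, 4, \<lambda>h. U (1, 1, 1) f, r (1, 1, 1)),
      (11 / 60480, 3, 4, T\<^sub>6, t\<^sub>6)])"

lemma even_partial_0: "even_partial \<Omega> (0, 0, 0) \<phi> = \<phi>"
  by (simp add: even_partial.simps mixed_partial_def)

lemma coefficient_expansions:
  "C\<^sub>1 K h * x = x + K ^ 6 / 20160 * of_real h ^ 6 * x"
  "C\<^sub>2 K h * x = 1 / 6 * of_real h ^ 2 * x + K ^ 2 / 180 * of_real h ^ 4 * x + K ^ 4 / 5040 * of_real h ^ 6 * x"
  "C\<^sub>3 K h * x = 1 / 30 * of_real h ^ 4 * x + 17 * K ^ 2 / 7560 * of_real h ^ 6 * x"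
  "C\<^sub>4 K h * x = K ^ 2 * x - K ^ 4 / 12 * of_real h ^ 2 * x + K ^ 6 / 360 * of_real h ^ 4 * x"
  "D\<^sub>1 K h * x = x - K ^ 2 / 12 * of_real h ^ 2 * x + K ^ 4 / 360 * of_real h ^ 4 * x"
  "D\<^sub>2 K h * x = K ^ 4 / 20160 * of_real h ^ 6 * x"
  "D\<^sub>3 K h * x = 1 / 90 * of_real h ^ 4 * x + K ^ 2 / 10080 * of_real h ^ 6 * x"
  "D\<^sub>4 K h * x = 1 / 12 * of_real h ^ 2 * x - K ^ 2 / 360 * of_real h ^ 4 * x"
  "D\<^sub>5 K h * x = 1 / 360 * of_real h ^ 4 * x - K ^ 2 / 20160 * of_real h ^ 6 * x"
  by (simp_all add: C\<^sub>1_def C\<^sub>2_def C\<^sub>3_def C\<^sub>4_def D\<^sub>1_def D\<^sub>2_def D\<^sub>3_def D\<^sub>4_def D\<^sub>5_def field_simps flip: power_add)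

lemma scheme_terms_residual:
  "(\<Sum>(d, k, r\<^sub>0, F, ts)\<leftarrow>scheme_terms K f. d * of_real h ^ (2 * k) * F h p)
   = scheme_lhs K h u p - (scheme_rhs \<Omega> K h f p + leading_error \<Omega> h u f p)"
  unfolding scheme_lhs_def scheme_rhs_def leading_error_def coefficient_expansions scheme_terms_def Let_def
  by (simp add: even_partial.simps b\<^sub>3_def b\<^sub>4_def b\<^sub>5_def b\<^sub>6_def of_real_divide of_real_mult)

lemma scheme_terms_have_expansions:
  assumes "m = 5" "helmholtz_solution \<Omega> K f u"
  shows "\<forall>(d, k, r\<^sub>0, F, ts) \<in> set (scheme_terms K f). has_expansion UNIV r\<^sub>0 F ts \<and> r\<^sub>0 \<le> 1 + k"
proof -
  have u: "has_expansion S 0 (\<lambda>h. u) [(0, 1, (0, 0, 0))]" for S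
    using has_expansion_even_partial[of "(0, 0, 0)" 0 S] assms(1) by (simp add: even_partial_0)
  have F: "has_expansion S r (\<lambda>h. even_partial \<Omega> \<alpha> f) (helmholtz_summands K \<alpha>)" if "half_order \<alpha> < r" "r < 5" for S r \<alpha>
    unfolding helmholtz_summands_def
    by (rule has_expansion_even_partial_helmholtz) (use that assms in auto)
  have f: "has_expansion S 1 (\<lambda>h. f) (helmholtz_summands K (0, 0, 0))" for S
    using F[of "(0, 0, 0)" 1 S] by (simp add: even_partial_0)
  have U: "has_expansion S r (\<lambda>h. even_partial \<Omega> \<alpha> u) [(0, 1, \<alpha>)]" if "half_order \<alpha> \<le> r" "r < 5" for S r \<alpha>
    by (rule has_expansion_even_partial) (use that assms in auto)
  have d: "has_expansion UNIV (2 + 1) (\<lambda>h. second_diff h i (even_partial \<Omega> \<alpha> f)) (second_diff_expansion 5 i 2 (helmholtz_summands K \<alpha>))"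
    if "half_order \<alpha> = 1" for i \<alpha>
    unfolding assms(1)[symmetric]
    by (rule has_expansion_mono[OF has_expansion_second_diff[OF F[where S = "{}"]]]) (use that assms(1) in auto)
  have G: "has_expansion UNIV 3 (\<lambda>h p. second_diff h 1 (even_partial \<Omega> (1, 0, 0) f) p
         + second_diff h 2 (even_partial \<Omega> (0, 1, 0) f) p + second_diff h 3 (even_partial \<Omega> (0, 0, 1) f) p)
      (second_diff_expansion 5 1 2 (helmholtz_summands K (1, 0, 0))
         @ second_diff_expansion 5 2 2 (helmholtz_summands K (0, 1, 0)) @ second_diff_expansion 5 3 2 (helmholtz_summands K (0, 0, 1)))"
    unfolding append_assoc[symmetric]
    using d by (intro has_expansion_add) simp_all
  have L: "has_expansion UNIV 2 (\<lambda>h p. even_partial \<Omega> (1, 0, 0) f p + even_partial \<Omega> (0, 1, 0) f p + even_partial \<Omega> (0, 0, 1) f p)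
      (helmholtz_summands K (1, 0, 0) @ helmholtz_summands K (0, 1, 0) @ helmholtz_summands K (0, 0, 1))"
    unfolding append_assoc[symmetric] by (intro has_expansion_add F) simp_all
  have T4: "has_expansion UNIV 4 (\<lambda>h p. even_partial \<Omega> (2, 2, 0) u p + even_partial \<Omega> (0, 2, 2) u p + even_partial \<Omega> (2, 0, 2) u p)
      ([(0, 1, (2, 2, 0))] @ [(0, 1, (0, 2, 2))] @ [(0, 1, (2, 0, 2))])"
    unfolding append_assoc[symmetric] by (intro has_expansion_add U) simp_all
  have T5: "has_expansion UNIV 4 (\<lambda>h p. even_partial \<Omega> (2, 1, 0) f p + even_partial \<Omega> (1, 2, 0) f p
        + even_partial \<Omega> (0, 2, 1) f p + even_partial \<Omega> (0, 1, 2) f p + even_partial \<Omega> (2, 0, 1) f p + even_partial \<Omega> (1, 0, 2) f p)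
      (helmholtz_summands K (2, 1, 0) @ helmholtz_summands K (1, 2, 0) @ helmholtz_summands K (0, 2, 1) @ helmholtz_summands K (0, 1, 2)
        @ helmholtz_summands K (2, 0, 1) @ helmholtz_summands K (1, 0, 2))"
    unfolding append_assoc[symmetric] by (intro has_expansion_add F) simp_all
  have T6: "has_expansion UNIV 4 (\<lambda>h p. even_partial \<Omega> (3, 0, 0) f p + even_partial \<Omega> (0, 3, 0) f p + even_partial \<Omega> (0, 0, 3) f p)
      (helmholtz_summands K (3, 0, 0) @ helmholtz_summands K (0, 3, 0) @ helmholtz_summands K (0, 0, 3))"
    unfolding append_assoc[symmetric] by (intro has_expansion_add F) simp_all
  show ?thesis
    using assms(1) has_expansion_single_diff[OF u] has_expansion_double_diff[OF u] has_expansion_triple_diff[OF u] u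
      has_expansion_single_diff[OF f] has_expansion_double_diff[OF f] f L G T4 T5 T6
      F[of "(1, 1, 1)" 4 UNIV]
    unfolding scheme_terms_def Let_def by (simp flip: numeral_2_eq_2 numeral_3_eq_3)
qed

end

section \<open>Collecting equal derivatives\<close>

text \<open>
  Summands with the same power of \<open>h\<close> and the same derivative are merged, so that the vanishing of
  an expansion reduces to identities between the coefficients, which involve \<open>K\<close> only.
\<close>
fun collect_summand :: "'a::plus summand \<Rightarrow> 'a summand list \<Rightarrow> 'a summand list" where
  "collect_summand \<tau> [] = [\<tau>]"
| "collect_summand (w, c, \<alpha>) ((w', c', \<alpha>') # ts) =
     (if w = w' \<and> \<alpha> = \<alpha>' then (w, c + c', \<alpha>) # ts else (w', c', \<alpha>') # collect_summand (w, c, \<alpha>) ts)"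

context smooth_on_box
begin

lemma expansion_value_collect_summand:
  "expansion_value (collect_summand \<tau> ts) h p = expansion_value (\<tau> # ts) h p"
  by (induction \<tau> ts rule: collect_summand.induct) (auto simp: algebra_simps)

lemma expansion_value_collect: "expansion_value (foldr collect_summand ts []) h p = expansion_value ts h p"
proof (induction ts)
  case (Cons \<tau> ts)
  obtain w c \<alpha> where "\<tau> = (w, c, \<alpha>)" by (cases \<tau>)
  then show ?case using Cons by (simp add: expansion_value_collect_summand)
qed simp

lemma expansion_value_eq_0:
  assumes "list_all (\<lambda>(w, c, \<alpha>). c = 0) (foldr collect_summand ts [])"
  shows "expansion_value ts h p = 0"
proof -
  have "expansion_value ts' h p = 0" if "list_all (\<lambda>(w, c, \<alpha>). c = 0) ts'" for ts'
    using that by (induction ts') auto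
  then show ?thesis using assms expansion_value_collect by metis
qed

text \<open>
  This is where the constants of the scheme matter: they are chosen such that the coefficients of
  \<open>h\<^sup>0, h\<^sup>2, h\<^sup>4\<close> agree on both sides and that those of \<open>h\<^sup>6\<close> differ by the leading error.
\<close>
lemma scheme_expansion_vanishes:
  "expansion_value (concat (map (\<lambda>(d, k, r\<^sub>0, F, ts). scale_expansion 5 d k 1 ts) (scheme_terms K f))) h p = 0"
proof -
  have upt: "[0..<4] = [0, 1, 2, 3]" "[0..<3] = [0, 1, 2]" "[0..<2] = [0, 1]" "[0..<1] = [0]"
    "[0..<Suc 0] = [0]" "[0..<Suc (Suc 0)] = [0, 1]"
    by (simp_all add: upt_rec)
  show ?thesis
    unfolding scheme_terms_def Let_def
    apply (rule expansion_value_eq_0)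
    \<comment> \<open>compute the list of all summands, about two hundred, without merging them yet\<close>
    apply (simp add: single_diff_expansion_def double_diff_expansion_def triple_diff_expansion_def
        second_diff_expansion_def helmholtz_summands_def scale_expansion_def upt fact_numeral
      del: collect_summand.simps list.pred_inject foldr_Cons foldr_append flip: numeral_2_eq_2)
    \<comment> \<open>merge them by rewriting with the bare equations: the coefficients stay unevaluated sums,
      which keeps arithmetic out of the many comparisons of exponents\<close>
    apply (simp only: One_nat_def[symmetric] collect_summand.simps foldr.simps o_apply id_apply prod.inject
      numeral_eq_iff num.distinct num.inject zero_neq_numeral numeral_neq_zero one_eq_numeral_iff numeral_eq_one_iff
      zero_neq_one one_neq_zero simp_thms if_True if_False)
    apply (simp only: list.pred_inject prod.case simp_thms)
    \<comment> \<open>one identity between polynomials in \<open>K\<close> for each power of \<open>h\<close> and each derivative\<close>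
    apply (intro conjI; simp add: field_simps)
    done
qed

lemma scheme_residual_bounded:
  assumes "m = 5" "helmholtz_solution \<Omega> K f u"
  shows "\<exists>M. \<forall>h. 0 < h \<and> h \<le> 1 \<longrightarrow> (\<forall>p \<in> reach h UNIV.
    norm (scheme_lhs K h u p - (scheme_rhs \<Omega> K h f p + leading_error \<Omega> h u f p)) \<le> M * h ^ 8)"
proof -
  have expansion: "has_expansion UNIV 1 (\<lambda>h p. \<Sum>(d, k, r\<^sub>0, F, ts)\<leftarrow>scheme_terms K f. d * of_real h ^ (2 * k) * F h p)
    (concat (map (\<lambda>(d, k, r\<^sub>0, F, ts). scale_expansion m d k 1 ts) (scheme_terms K f)))"
    by (rule has_expansion_combination[OF scheme_terms_have_expansions[OF assms]]) (simp add: assms(1))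
  show ?thesis
    using expansion[unfolded has_expansion_def, THEN conjunct2]
    unfolding assms(1) scheme_terms_residual scheme_expansion_vanishes by simp
qed

end

section \<open>The truncation error at interior grid points\<close>

text \<open>
  The leading error is \<open>h\<^sup>6\<close> times its value for \<open>h = 1\<close>, a continuous function on the compact box.
\<close>
lemma (in nondegenerate_box) leading_error_bounded:
  fixes u f :: "real ^ 3 \<Rightarrow> 'a::real_normed_field"
  assumes "Ck_on \<Omega> 8 u" "Ck_on \<Omega> 8 f"
  shows "\<exists>M. \<forall>h>0. \<forall>p\<in>\<Omega>. norm (leading_error \<Omega> h u f p) \<le> M * h ^ 6"
proof -
  have C: "Ck_on \<Omega> 0 (mixed_partial \<Omega> r s t \<phi>)" if "Ck_on \<Omega> 8 \<phi>" "r + s + t \<le> 8" for r s t and \<phi> :: "real ^ 3 \<Rightarrow> 'a"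
    by (rule Ck_mixed_partial, rule Ck_mono[OF that(1)]) (use that(2) in simp)
  have "Ck_on \<Omega> 0 (leading_error \<Omega> 1 u f)"
    unfolding leading_error_def[abs_def] by (intro Ck_add Ck_mult C assms) simp_all
  then obtain B where B: "0 \<le> B" "\<And>p. p \<in> \<Omega> \<Longrightarrow> norm (leading_error \<Omega> 1 u f p) \<le> B"
    by (rule Ck_bounded) blast
  have homogeneous: "leading_error \<Omega> h u f p = of_real (h ^ 6) * leading_error \<Omega> 1 u f p" for h p
  proof -
    have "b\<^sub>3 h = h ^ 6 * b\<^sub>3 1" "b\<^sub>4 h = h ^ 6 * b\<^sub>4 1" "b\<^sub>5 h = h ^ 6 * b\<^sub>5 1" "b\<^sub>6 h = h ^ 6 * b\<^sub>6 1"
      by (simp_all add: b\<^sub>3_def b\<^sub>4_def b\<^sub>5_def b\<^sub>6_def)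
    then show ?thesis
      unfolding leading_error_def by (simp only: of_real_mult distrib_left mult.assoc)
  qed
  have "norm (leading_error \<Omega> h u f p) \<le> B * h ^ 6" if "0 < h" "p \<in> \<Omega>" for h p
  proof -
    have "norm (leading_error \<Omega> h u f p) = h ^ 6 * norm (leading_error \<Omega> 1 u f p)"
      unfolding homogeneous[of h] using that(1) by (simp add: norm_mult norm_power)
    also have "\<dots> \<le> h ^ 6 * B"
      using that B(2) by (intro mult_left_mono) auto
    finally show ?thesis by (simp add: mult.commute)
  qed
  then show ?thesis by blast
qed

lemma (in nondegenerate_box) interior_grid_points_reach:
  assumes "p \<in> interior_grid_points \<Omega> c h"
  shows "p \<in> reach h UNIV"
proof -
  have "p \<in> \<Omega>" "stencil h p \<subseteq> \<Omega>"
    using assms by (auto simp: interior_grid_points_def grid_points_def)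
  moreover have "p - h *\<^sub>R axis i 1 \<in> stencil h p" "p + h *\<^sub>R axis i 1 \<in> stencil h p" for i
    by (auto simp: stencil_def axis_def)
  ultimately show ?thesis by (auto simp: reach_def)
qed

theorem mainTheorem2:
  fixes K :: "'a::{real_normed_field, banach}"
    and u f :: "real ^ 3 \<Rightarrow> 'a"
    and a b :: "real ^ 3"
    and \<Omega> :: "(real ^ 3) set"
  assumes box: "\<And>i. a $ i < b $ i" "\<Omega> = cbox a b"
    and u_smooth: "Ck_on \<Omega> 10 u"
    and f_smooth: "Ck_on \<Omega> 8 f"
    and helmholtz: "helmholtz_solution \<Omega> K f u"
  shows "(\<exists>M. \<forall>\<^sub>F h in at_right 0. \<forall>c. \<forall>p \<in> interior_grid_points \<Omega> c h.
           norm (scheme_lhs K h u p - (scheme_rhs \<Omega> K h f p + leading_error \<Omega> h u f p)) \<le> M * h ^ 8) \<and>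
         (\<exists>M. \<forall>\<^sub>F h in at_right 0. \<forall>c. \<forall>p \<in> interior_grid_points \<Omega> c h.
           norm (leading_error \<Omega> h u f p) \<le> M * h ^ 6)"
proof -
  interpret smooth_on_box a b \<Omega> 5 u
    by unfold_locales (use box u_smooth in auto)
  obtain M where M: "\<And>h p. 0 < h \<Longrightarrow> h \<le> 1 \<Longrightarrow> p \<in> reach h UNIV \<Longrightarrow>
      norm (scheme_lhs K h u p - (scheme_rhs \<Omega> K h f p + leading_error \<Omega> h u f p)) \<le> M * h ^ 8"
    using scheme_residual_bounded[OF refl helmholtz] by blast
  obtain M' where M': "\<And>h p. 0 < h \<Longrightarrow> p \<in> \<Omega> \<Longrightarrow> norm (leading_error \<Omega> h u f p) \<le> M' * h ^ 6"
    using leading_error_bounded[OF Ck_mono[OF u_smooth] f_smooth] by auto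
  have small: "\<forall>\<^sub>F h in at_right (0::real). 0 < h \<and> h \<le> 1"
    unfolding eventually_at_right_field by (intro exI[of _ 1]) auto
  show ?thesis
  proof (intro conjI)
    show "\<exists>M. \<forall>\<^sub>F h in at_right 0. \<forall>c. \<forall>p \<in> interior_grid_points \<Omega> c h.
        norm (scheme_lhs K h u p - (scheme_rhs \<Omega> K h f p + leading_error \<Omega> h u f p)) \<le> M * h ^ 8"
      by (rule exI[of _ M], rule eventually_mono[OF small]) (auto intro!: M interior_grid_points_reach)
    show "\<exists>M. \<forall>\<^sub>F h in at_right 0. \<forall>c. \<forall>p \<in> interior_grid_points \<Omega> c h.
        norm (leading_error \<Omega> h u f p) \<le> M * h ^ 6"
      by (rule exI[of _ M'], rule eventually_mono[OF small])
        (auto intro!: M' dest!: interior_grid_points_reach simp: reach_def)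
  qed
qed

end
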